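(* (i) For $\lambda>0$ and $1/2\le\beta<1$, $\operatorname{Var}(u(\alpha t-\lambda t^{\beta},t))\sim t^{\beta}$. (ii) For $\lambda>0$, $\operatorname{Var}(u(\alpha t+\sigma\sqrt{\lambda t\log t},t))\sim \dfrac{t^{1/2-\lambda}}{(\log t)^{3/2}}$.
   Context: Fix $\alpha\in(0,1)$ and let $\sigma=\sqrt{\alpha(1-\alpha)}$. Let $W$ be a standard one-dimensional Brownian motion on $[0,\infty)$. The continuous one-dimensional Conga line is, for $x>0$, $t>0$, $$u(x,t)=\int_0^t\overline{\Phi}\left(\frac{x-\alpha z}{\sigma\sqrt z}\right)dW^t_z,\qquad W^t_z=W(t)-W(t-z),\ 0\le z\le t,$$ where $\overline\Phi=1-\Phi$ and $\Phi$ is the standard normal distribution function. For positive functions $f,g$, $f(t)\sim g(t)$ means that there is a constant $C<\infty$ such that $\frac{f(t)}{g(t)}\vee\frac{g(t)}{f(t)}\le C$ for all sufficiently large $t$. *)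

theory Defs
  imports "HOL-Probability.Probability"
begin

definition standard_brownian_motion :: "'a measure \<Rightarrow> (real \<Rightarrow> 'a \<Rightarrow> real) \<Rightarrow> bool" where
  "standard_brownian_motion M W \<longleftrightarrow>
     prob_space M \<and>
     (\<forall>t\<ge>0. W t \<in> borel_measurable M) \<and>
     (AE \<omega> in M. W 0 \<omega> = 0) \<and>
     (\<forall>s t. 0 \<le> s \<and> s < t \<longrightarrow>
        distributed M lborel (\<lambda>\<omega>. W t \<omega> - W s \<omega>) (normal_density 0 (sqrt (t - s)))) \<and>
     (\<forall>(n::nat) p. 0 \<le> p 0 \<and> (\<forall>i<n. p i \<le> p (Suc i)) \<longrightarrow>
        prob_space.indep_vars M (\<lambda>_. borel) (\<lambda>i \<omega>. W (p (Suc i)) \<omega> - W (p i) \<omega>) {..<n}) \<and>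
     (AE \<omega> in M. continuous_on {0..} (\<lambda>t. W t \<omega>))"

text \<open>
  The stochastic integral of a deterministic integrand \<open>f\<close> over \<open>[0, T]\<close> with respect to a
  process \<open>B\<close> is the mean-square limit of the integrals of step functions that approximate
  \<open>f\<close> in \<open>L\<^sup>2[0, T]\<close>. A step function is given by its number of pieces \<open>n\<close>, its
  subdivision points \<open>p 0 \<le> \<dots> \<le> p n\<close> and its values \<open>c 0, \<dots>, c (n - 1)\<close>.
\<close>

definition is_subdivision :: "real \<Rightarrow> nat \<Rightarrow> (nat \<Rightarrow> real) \<Rightarrow> bool" where
  "is_subdivision T n p \<longleftrightarrow> p 0 = 0 \<and> p n = T \<and> (\<forall>i<n. p i \<le> p (Suc i))"

definition step_fun :: "nat \<Rightarrow> (nat \<Rightarrow> real) \<Rightarrow> (nat \<Rightarrow> real) \<Rightarrow> real \<Rightarrow> real" where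
  "step_fun n p c z = (\<Sum>i<n. c i * indicator {p i<..p (Suc i)} z)"

definition step_integral ::
  "(real \<Rightarrow> 'a \<Rightarrow> real) \<Rightarrow> nat \<Rightarrow> (nat \<Rightarrow> real) \<Rightarrow> (nat \<Rightarrow> real) \<Rightarrow> 'a \<Rightarrow> real" where
  "step_integral B n p c \<omega> = (\<Sum>i<n. c i * (B (p (Suc i)) \<omega> - B (p i) \<omega>))"

text \<open>
  The errors are measured by nonnegative integrals, so that convergence to 0 includes
  square integrability (a Bochner integral would be 0 in the nonintegrable case).
\<close>

definition has_wiener_integral ::
  "'a measure \<Rightarrow> (real \<Rightarrow> 'a \<Rightarrow> real) \<Rightarrow> real \<Rightarrow> (real \<Rightarrow> real) \<Rightarrow> ('a \<Rightarrow> real) \<Rightarrow> bool" where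
  "has_wiener_integral M B T f J \<longleftrightarrow>
     set_borel_measurable lborel {0..T} f \<and>
     J \<in> borel_measurable M \<and>
     (\<exists>n p c. (\<forall>k. is_subdivision T (n k) (p k)) \<and>
        (\<lambda>k::nat. \<integral>\<^sup>+z\<in>{0..T}. ennreal ((f z - step_fun (n k) (p k) (c k) z)\<^sup>2) \<partial>lborel)
          \<longlonglongrightarrow> 0 \<and>
        (\<lambda>k. \<integral>\<^sup>+\<omega>. ennreal ((J \<omega> - step_integral B (n k) (p k) (c k) \<omega>)\<^sup>2) \<partial>M)
          \<longlonglongrightarrow> 0)"

text \<open>For a Brownian motion \<open>B\<close> the integral is determined up to a null set; a version is chosen.\<close>

definition wiener_integral ::
  "'a measure \<Rightarrow> (real \<Rightarrow> 'a \<Rightarrow> real) \<Rightarrow> real \<Rightarrow> (real \<Rightarrow> real) \<Rightarrow> 'a \<Rightarrow> real" where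
  "wiener_integral M B T f = (SOME J. has_wiener_integral M B T f J)"

definition std_normal_tail :: "real \<Rightarrow> real" where
  "std_normal_tail y = 1 - cdf std_normal_distribution y"

definition reversed_process :: "(real \<Rightarrow> 'a \<Rightarrow> real) \<Rightarrow> real \<Rightarrow> real \<Rightarrow> 'a \<Rightarrow> real" where
  "reversed_process W t z \<omega> = W t \<omega> - W (t - z) \<omega>"

definition conga_sigma :: "real \<Rightarrow> real" where
  "conga_sigma \<alpha> = sqrt (\<alpha> * (1 - \<alpha>))"

definition conga_line ::
  "'a measure \<Rightarrow> (real \<Rightarrow> 'a \<Rightarrow> real) \<Rightarrow> real \<Rightarrow> real \<Rightarrow> real \<Rightarrow> 'a \<Rightarrow> real" where
  "conga_line M W \<alpha> x t =
     wiener_integral M (reversed_process W t) t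
       (\<lambda>z. std_normal_tail ((x - \<alpha> * z) / (conga_sigma \<alpha> * sqrt z)))"

text \<open>
  Eventual positivity is part of the relation: since \<open>a / 0 = 0\<close>, the bound on the quotients
  alone would hold trivially for a vanishing function.
\<close>

definition same_order :: "(real \<Rightarrow> real) \<Rightarrow> (real \<Rightarrow> real) \<Rightarrow> bool" where
  "same_order f g \<longleftrightarrow>
     (\<forall>\<^sub>F t in at_top. f t > 0 \<and> g t > 0) \<and>
     (\<exists>C. \<forall>\<^sub>F t in at_top. max (f t / g t) (g t / f t) \<le> C)"

end

theory Submission
  imports Defs "HOL-Real_Asymp.Real_Asymp"
begin

text \<open>
  The integrand of the Conga line is deterministic, so the isometry of the stochastic integral
  turns the variance into the integral of \<open>Q(y(z))\<^sup>2\<close> over \<open>0 < z \<le> t\<close>, where \<open>Q\<close> is the normal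
  tail and \<open>y(z) = (x - \<alpha> z) / (\<sigma> sqrt z)\<close> (\<open>variance_conga_line\<close>). What remains is to see how
  much of the interval near \<open>z = t\<close> contributes; put \<open>s = t - z\<close>.

  For \<open>x = \<alpha> t - l t\<^sup>\<beta>\<close> the argument is nonpositive exactly for \<open>s \<le> l t\<^sup>\<beta> / \<alpha>\<close>. On this range the
  tail lies between \<open>Q(0)\<close> and 1, which gives the order \<open>t\<^sup>\<beta>\<close>. Beyond twice this range \<open>y\<close> grows
  at least like \<open>\<alpha> s / (2 \<sigma> sqrt t)\<close>, and the rest contributes only \<open>O(sqrt t)\<close>, which is
  absorbed because \<open>\<beta> \<ge> 1/2\<close> (\<open>same_order_variance_behind_front\<close>).

  For \<open>x = \<alpha> t + \<sigma> sqrt (l t ln t)\<close> the argument starts at \<open>a = sqrt (l ln t)\<close> for \<open>s = 0\<close> and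
  satisfies \<open>y \<ge> a + b s\<close> with \<open>b = \<alpha> / (\<sigma> sqrt t)\<close>. As \<open>Q(y)\<^sup>2\<close> has the order of
  \<open>exp(- y\<^sup>2) / y\<^sup>2\<close>, it is about \<open>t\<^sup>-\<^sup>l / ln t\<close> at \<open>s = 0\<close> and decays at rate \<open>2 a b\<close>, hence lives on
  the scale \<open>1 / (a b)\<close>, of order \<open>sqrt (t / ln t)\<close>. The product of height and width is the claimed
  order (\<open>same_order_variance_ahead_of_front\<close>).

  The isometry rests on second moments: \<open>E (B t - B s)\<^sup>2 = \<bar>t - s\<bar>\<close> determines the
  covariance of any two increments by polarization, as the length of the overlap of the two
  intervals. This is visibly stable under time reversal, and it makes step integrals over different
  subdivisions comparable without a common refinement. Completeness of \<open>L\<^sup>2\<close> supplies the integral of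
  a limit of step functions.
\<close>

section \<open>Convergence in mean square\<close>

text \<open>
  Young's inequality; a free weight \<open>d\<close> lets the coefficient of one square go to 0 in
  \<open>tendsto_integral_square\<close>.
\<close>

lemma abs_mult_le_weighted_squares:
  fixes b c d :: real
  assumes "0 < d"
  shows "\<bar>2 * (b * c)\<bar> \<le> c\<^sup>2 / d + d * b\<^sup>2"
proof -
  have "\<bar>2 * (b * c)\<bar> = 2 * (\<bar>c\<bar> / sqrt d) * (sqrt d * \<bar>b\<bar>)"
    using assms by (simp add: abs_mult)
  also have "\<dots> \<le> (\<bar>c\<bar> / sqrt d)\<^sup>2 + (sqrt d * \<bar>b\<bar>)\<^sup>2"
    by (rule sum_squares_bound)
  also have "\<dots> = c\<^sup>2 / d + d * b\<^sup>2"
    using assms by (simp add: power_divide power_mult_distrib)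
  finally show ?thesis .
qed

text \<open>
  Mean-square convergence carries square integrability and the second moment over to the limit:
  \<open>\<bar>S\<^sup>2 - J\<^sup>2\<bar> \<le> (1 + 1/d) (J - S)\<^sup>2 + d J\<^sup>2\<close> for every \<open>d > 0\<close>, and a \<open>d\<close> that tends to 0 but
  dominates the root mean square error makes both terms vanish. It is used twice: in \<open>\<omega>\<close> for the step integrals and in
  \<open>z\<close> for the step functions.
\<close>

lemma tendsto_integral_square:
  fixes S :: "nat \<Rightarrow> 'a \<Rightarrow> real"
  assumes [measurable]: "J \<in> borel_measurable M" "\<And>k. S k \<in> borel_measurable M"
    and S2: "\<And>k. integrable M (\<lambda>x. (S k x)\<^sup>2)"
    and lim: "(\<lambda>k. \<integral>\<^sup>+x. ennreal ((J x - S k x)\<^sup>2) \<partial>M) \<longlonglongrightarrow> 0"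
  shows "integrable M (\<lambda>x. (J x)\<^sup>2)"
    and "\<And>k. integrable M (\<lambda>x. (J x - S k x)\<^sup>2)"
    and "(\<lambda>k. \<integral>x. (J x - S k x)\<^sup>2 \<partial>M) \<longlonglongrightarrow> 0"
    and "(\<lambda>k. \<integral>x. (S k x)\<^sup>2 \<partial>M) \<longlonglongrightarrow> (\<integral>x. (J x)\<^sup>2 \<partial>M)"
proof -
  have sq: "(a + b)\<^sup>2 \<le> 2 * a\<^sup>2 + 2 * b\<^sup>2" for a b :: real
    using zero_le_power2[of "a - b"] by (simp add: power2_eq_square algebra_simps)
  have "\<forall>\<^sub>F k in sequentially. (\<integral>\<^sup>+x. ennreal ((J x - S k x)\<^sup>2) \<partial>M) < 1"
    using lim by (rule order_tendstoD) simp
  then obtain k0 where "(\<integral>\<^sup>+x. ennreal ((J x - S k0 x)\<^sup>2) \<partial>M) < 1"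
    by (auto simp: eventually_sequentially)
  then have "(\<integral>\<^sup>+x. ennreal ((J x - S k0 x)\<^sup>2) \<partial>M) < \<infinity>"
    by (rule less_trans) simp
  then have i0: "integrable M (\<lambda>x. (J x - S k0 x)\<^sup>2)"
    by (intro integrableI_nonneg) auto
  show J2: "integrable M (\<lambda>x. (J x)\<^sup>2)"
  proof (rule Bochner_Integration.integrable_bound)
    show "integrable M (\<lambda>x. 2 * (J x - S k0 x)\<^sup>2 + 2 * (S k0 x)\<^sup>2)"
      using i0 S2 by simp
    show "AE x in M. norm ((J x)\<^sup>2) \<le> norm (2 * (J x - S k0 x)\<^sup>2 + 2 * (S k0 x)\<^sup>2)"
      using sq[of "J x - S k0 x" "S k0 x" for x] by (intro AE_I2) simp
  qed simp
  show d2: "integrable M (\<lambda>x. (J x - S k x)\<^sup>2)" for k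
  proof (rule Bochner_Integration.integrable_bound)
    show "integrable M (\<lambda>x. 2 * (J x)\<^sup>2 + 2 * (S k x)\<^sup>2)"
      using J2 S2 by simp
    show "AE x in M. norm ((J x - S k x)\<^sup>2) \<le> norm (2 * (J x)\<^sup>2 + 2 * (S k x)\<^sup>2)"
      using sq[of "J x" "- S k x" for x] by (intro AE_I2) simp
  qed simp
  define e where "e k = (\<integral>x. (J x - S k x)\<^sup>2 \<partial>M)" for k
  have e_nn: "0 \<le> e k" for k
    unfolding e_def by simp
  have "(\<lambda>k. ennreal (e k)) \<longlonglongrightarrow> ennreal 0"
    using lim nn_integral_eq_integral[OF d2] by (simp add: e_def)
  then have e0: "e \<longlonglongrightarrow> 0"
    by (subst (asm) tendsto_ennreal_iff) (use e_nn in auto)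
  then show "(\<lambda>k. \<integral>x. (J x - S k x)\<^sup>2 \<partial>M) \<longlonglongrightarrow> 0"
    by (simp add: e_def[abs_def])
  \<comment> \<open>the second summand keeps the weight positive when the error vanishes\<close>
  define d where "d k = sqrt (e k) + 1 / real (Suc k)" for k
  have d_pos: "0 < d k" for k
    using e_nn[of k] by (simp add: d_def add_nonneg_pos)
  have "(\<lambda>k. sqrt (e k) + 1 / real (Suc k)) \<longlonglongrightarrow> sqrt 0 + 0"
    using LIMSEQ_inverse_real_of_nat
    by (intro tendsto_add tendsto_real_sqrt e0) (simp add: inverse_eq_divide)
  then have d0: "d \<longlonglongrightarrow> 0"
    by (simp add: d_def[abs_def])
  have bnd: "\<bar>(\<integral>x. (S k x)\<^sup>2 \<partial>M) - (\<integral>x. (J x)\<^sup>2 \<partial>M)\<bar> \<le> e k + sqrt (e k) + d k * (\<integral>x. (J x)\<^sup>2 \<partial>M)" for k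
  proof -
    have pt: "\<bar>a\<^sup>2 - b\<^sup>2\<bar> \<le> (1 + 1 / d k) * (b - a)\<^sup>2 + d k * b\<^sup>2" for a b
    proof -
      have "a\<^sup>2 - b\<^sup>2 = (b - a)\<^sup>2 + - (2 * (b * (b - a)))"
        by (simp add: power2_eq_square algebra_simps)
      then have "\<bar>a\<^sup>2 - b\<^sup>2\<bar> \<le> \<bar>(b - a)\<^sup>2\<bar> + \<bar>- (2 * (b * (b - a)))\<bar>"
        by (simp only: abs_triangle_ineq)
      also have "\<dots> \<le> (b - a)\<^sup>2 + ((b - a)\<^sup>2 / d k + d k * b\<^sup>2)"
        unfolding abs_minus_cancel abs_power2 by (intro add_left_mono abs_mult_le_weighted_squares d_pos)
      finally show ?thesis
        by (simp only: distrib_right mult_1_left times_divide_eq_left add.assoc)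
    qed
    have "\<bar>(\<integral>x. (S k x)\<^sup>2 \<partial>M) - (\<integral>x. (J x)\<^sup>2 \<partial>M)\<bar> = \<bar>\<integral>x. (S k x)\<^sup>2 - (J x)\<^sup>2 \<partial>M\<bar>"
      using S2 J2 by simp
    also have "\<dots> \<le> (\<integral>x. \<bar>(S k x)\<^sup>2 - (J x)\<^sup>2\<bar> \<partial>M)"
      by (rule integral_abs_bound)
    also have "\<dots> \<le> (\<integral>x. (1 + 1 / d k) * (J x - S k x)\<^sup>2 + d k * (J x)\<^sup>2 \<partial>M)"
      using S2 J2 d2 by (intro integral_mono pt) auto
    also have "\<dots> = (1 + 1 / d k) * e k + d k * (\<integral>x. (J x)\<^sup>2 \<partial>M)"
      using J2 d2[of k] by (simp add: e_def)
    also have "e k / d k \<le> sqrt (e k)"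
    proof -
      have "e k = sqrt (e k) * sqrt (e k)"
        using e_nn by simp
      also have "\<dots> \<le> sqrt (e k) * d k"
        using e_nn by (intro mult_left_mono) (auto simp: d_def)
      finally show ?thesis
        using d_pos[of k] by (simp add: field_simps)
    qed
    then have "(1 + 1 / d k) * e k \<le> e k + sqrt (e k)"
      by (simp add: algebra_simps)
    finally show ?thesis by simp
  qed
  have "(\<lambda>k. \<bar>(\<integral>x. (S k x)\<^sup>2 \<partial>M) - (\<integral>x. (J x)\<^sup>2 \<partial>M)\<bar>) \<longlonglongrightarrow> 0"
  proof (rule tendsto_sandwich[OF _ _ tendsto_const])
    show "(\<lambda>k. e k + sqrt (e k) + d k * (\<integral>x. (J x)\<^sup>2 \<partial>M)) \<longlonglongrightarrow> 0"
      by (rule tendsto_eq_intros e0 d0 refl)+ simp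
  qed (intro always_eventually allI bnd abs_ge_zero)+
  then show "(\<lambda>k. \<integral>x. (S k x)\<^sup>2 \<partial>M) \<longlonglongrightarrow> (\<integral>x. (J x)\<^sup>2 \<partial>M)"
    by (simp add: tendsto_rabs_zero_iff LIM_zero_iff)
qed

text \<open>
  Riesz--Fischer in a quantitative form. A subsequence with rapidly decreasing errors converges
  almost everywhere, because its increments are absolutely summable there, and Fatou's lemma
  compares the limit with any member of the original sequence.
\<close>

lemma L2_complete:
  fixes X :: "nat \<Rightarrow> 'a \<Rightarrow> real"
  assumes X[measurable]: "\<And>k. X k \<in> borel_measurable M"
    and e: "e \<longlonglongrightarrow> 0" "\<And>k. 0 \<le> e k"
    and cauchy: "\<And>m n. (\<integral>\<^sup>+x. ennreal ((X m x - X n x)\<^sup>2) \<partial>M) \<le> ennreal (e m + e n)"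
  obtains J where "J \<in> borel_measurable M"
    "\<And>k. (\<integral>\<^sup>+x. ennreal ((J x - X k x)\<^sup>2) \<partial>M) \<le> ennreal (e k)"
proof -
  have "\<exists>r. e r \<le> (1/8) ^ j" for j
  proof -
    have "\<forall>\<^sub>F r in sequentially. e r < (1/8) ^ j"
      using e(1) by (rule order_tendstoD) simp
    then show ?thesis
      by (auto simp: eventually_sequentially intro: less_imp_le)
  qed
  then obtain r where r: "\<And>j. e (r j) \<le> (1/8) ^ j"
    by metis
  define Y where "Y j = X (r j)" for j
  have Y[measurable]: "Y j \<in> borel_measurable M" for j
    by (simp add: Y_def)
  \<comment> \<open>the weights \<open>2 ^ j\<close> turn a bound on the weighted squares into summability of the increments\<close>
  have step: "(\<integral>\<^sup>+x. ennreal (2 ^ j * (Y (Suc j) x - Y j x)\<^sup>2) \<partial>M) \<le> ennreal (2 * (1/4) ^ j)" for j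
  proof -
    have "(\<integral>\<^sup>+x. ennreal (2 ^ j * (Y (Suc j) x - Y j x)\<^sup>2) \<partial>M)
        = ennreal (2 ^ j) * (\<integral>\<^sup>+x. ennreal ((Y (Suc j) x - Y j x)\<^sup>2) \<partial>M)"
      by (subst nn_integral_cmult[symmetric]) (auto simp: ennreal_mult)
    also have "\<dots> \<le> ennreal (2 ^ j) * ennreal (e (r (Suc j)) + e (r j))"
      unfolding Y_def by (intro mult_left_mono cauchy) simp
    also have "\<dots> \<le> ennreal (2 ^ j) * ennreal (2 * (1/8) ^ j)"
      using r[of j] r[of "Suc j"] e(2)[of "r (Suc j)"]
      by (intro mult_left_mono ennreal_leI) auto
    also have "\<dots> = ennreal (2 * (1/4) ^ j)"
      by (subst ennreal_mult[symmetric]) (auto simp: power_mult_distrib[symmetric] mult.left_commute)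
    finally show ?thesis .
  qed
  have "(\<integral>\<^sup>+x. (\<Sum>j. ennreal (2 ^ j * (Y (Suc j) x - Y j x)\<^sup>2)) \<partial>M)
      = (\<Sum>j. \<integral>\<^sup>+x. ennreal (2 ^ j * (Y (Suc j) x - Y j x)\<^sup>2) \<partial>M)"
    by (intro nn_integral_suminf) simp
  also have "\<dots> \<le> (\<Sum>j. ennreal (2 * (1/4) ^ j))"
    by (intro suminf_le step) auto
  also have "\<dots> < \<infinity>"
    by (subst suminf_ennreal2) (auto intro: summable_mult summable_geometric)
  finally have "AE x in M. (\<Sum>j. ennreal (2 ^ j * (Y (Suc j) x - Y j x)\<^sup>2)) \<noteq> \<infinity>"
    by (intro nn_integral_noteq_infinite) auto
  then have conv: "AE x in M. (\<lambda>j. Y j x) \<longlonglongrightarrow> lim (\<lambda>j. Y j x)"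
  proof eventually_elim
    case (elim x)
    have "summable (\<lambda>j. 2 ^ j * (Y (Suc j) x - Y j x)\<^sup>2)"
      by (rule summable_suminf_not_top) (use elim in auto)
    then have "summable (\<lambda>j. (1/2) ^ j + 2 ^ j * (Y (Suc j) x - Y j x)\<^sup>2)"
      by (intro summable_add summable_geometric) auto
    then have "summable (\<lambda>j. Y (Suc j) x - Y j x)"
    proof (rule summable_comparison_test'[where N = 0])
      fix j
      have le_of_double: "0 \<le> a - 2 * b \<Longrightarrow> 0 \<le> b \<Longrightarrow> b \<le> a" for a b :: real
        by simp
      \<comment> \<open>the inequality of arithmetic and geometric means\<close>
      have "0 \<le> ((1/2) ^ j) * (1 - 2 ^ j * \<bar>Y (Suc j) x - Y j x\<bar>)\<^sup>2"
        by simp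
      also have "\<dots> = (1/2) ^ j + 2 ^ j * (Y (Suc j) x - Y j x)\<^sup>2 - 2 * \<bar>Y (Suc j) x - Y j x\<bar>"
        by (simp add: power2_diff power_mult_distrib field_simps power2_eq_square)
      finally show "norm (Y (Suc j) x - Y j x) \<le> (1/2) ^ j + 2 ^ j * (Y (Suc j) x - Y j x)\<^sup>2"
        unfolding real_norm_def by (rule le_of_double) simp
    qed
    then have "convergent (\<lambda>n. \<Sum>j<n. Y (Suc j) x - Y j x)"
      by (simp add: summable_iff_convergent)
    then have "convergent (\<lambda>n. Y n x - Y 0 x)"
      unfolding sum_lessThan_telescope[of "\<lambda>j. Y j x"] .
    then have "convergent (\<lambda>n. (Y n x - Y 0 x) + Y 0 x)"
      by (intro convergent_add convergent_const)
    then show ?case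
      by (simp add: convergent_LIMSEQ_iff)
  qed
  define J where "J x = lim (\<lambda>j. Y j x)" for x
  have J[measurable]: "J \<in> borel_measurable M"
    unfolding J_def[abs_def] by measurable
  have "(\<integral>\<^sup>+x. ennreal ((J x - X k x)\<^sup>2) \<partial>M) \<le> ennreal (e k)" for k
  proof -
    have er: "(\<lambda>j. ennreal (e (r j) + e k)) \<longlonglongrightarrow> ennreal (0 + e k)"
    proof (intro tendsto_ennrealI tendsto_add tendsto_const)
      show "(\<lambda>j. e (r j)) \<longlonglongrightarrow> 0"
        by (rule tendsto_sandwich[OF _ _ tendsto_const LIMSEQ_power_zero[of "1/8::real"]])
           (use e(2) r in auto)
    qed
    have "(\<integral>\<^sup>+x. ennreal ((J x - X k x)\<^sup>2) \<partial>M) = (\<integral>\<^sup>+x. liminf (\<lambda>j. ennreal ((Y j x - X k x)\<^sup>2)) \<partial>M)"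
    proof (rule nn_integral_cong_AE, use conv in eventually_elim)
      case (elim x)
      then have "(\<lambda>j. ennreal ((Y j x - X k x)\<^sup>2)) \<longlonglongrightarrow> ennreal ((J x - X k x)\<^sup>2)"
        unfolding J_def by (intro tendsto_ennrealI tendsto_intros)
      then show ?case
        by (intro lim_imp_Liminf[symmetric]) simp_all
    qed
    also have "\<dots> \<le> liminf (\<lambda>j. \<integral>\<^sup>+x. ennreal ((Y j x - X k x)\<^sup>2) \<partial>M)"
      by (rule nn_integral_liminf) simp
    also have "\<dots> \<le> liminf (\<lambda>j. ennreal (e (r j) + e k))"
      unfolding Y_def by (intro Liminf_mono always_eventually allI cauchy)
    also have "\<dots> = ennreal (e k)"
      using lim_imp_Liminf[OF _ er] by simp
    finally show ?thesis .
  qed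
  with J show thesis
    by (rule that)
qed

section \<open>Step integrals against a process with Wiener increments\<close>

text \<open>
  The second-order structure that Brownian motion shares with its time reversal. The condition is
  symmetric in \<open>s\<close> and \<open>t\<close> in order to cover both.
\<close>

definition wiener_increments :: "'a measure \<Rightarrow> (real \<Rightarrow> 'a \<Rightarrow> real) \<Rightarrow> real \<Rightarrow> bool" where
  "wiener_increments M B T \<longleftrightarrow>
     (\<forall>t\<in>{0..T}. B t \<in> borel_measurable M) \<and>
     (\<forall>s\<in>{0..T}. \<forall>t\<in>{0..T}.
        integrable M (\<lambda>\<omega>. B t \<omega> - B s \<omega>) \<and> (\<integral>\<omega>. B t \<omega> - B s \<omega> \<partial>M) = 0 \<and>
        integrable M (\<lambda>\<omega>. (B t \<omega> - B s \<omega>)\<^sup>2) \<and> (\<integral>\<omega>. (B t \<omega> - B s \<omega>)\<^sup>2 \<partial>M) = \<bar>t - s\<bar>)"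

lemma brownian_increment:
  assumes W: "standard_brownian_motion M W" and st: "0 \<le> s" "s \<le> t"
  shows "integrable M (\<lambda>\<omega>. W t \<omega> - W s \<omega>)" "(\<integral>\<omega>. W t \<omega> - W s \<omega> \<partial>M) = 0"
    "integrable M (\<lambda>\<omega>. (W t \<omega> - W s \<omega>)\<^sup>2)" "(\<integral>\<omega>. (W t \<omega> - W s \<omega>)\<^sup>2 \<partial>M) = t - s"
proof -
  interpret prob_space M
    using W by (simp add: standard_brownian_motion_def)
  have "integrable M (\<lambda>\<omega>. W t \<omega> - W s \<omega>) \<and> (\<integral>\<omega>. W t \<omega> - W s \<omega> \<partial>M) = 0 \<and>
    integrable M (\<lambda>\<omega>. (W t \<omega> - W s \<omega>)\<^sup>2) \<and> (\<integral>\<omega>. (W t \<omega> - W s \<omega>)\<^sup>2 \<partial>M) = t - s"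
  proof (cases "s = t")
    case False
    then have "s < t" using st by simp
    define \<sigma> where "\<sigma> = sqrt (t - s)"
    have \<sigma>: "0 < \<sigma>" "\<sigma>\<^sup>2 = t - s"
      using \<open>s < t\<close> by (auto simp: \<sigma>_def)
    have D: "distributed M lborel (\<lambda>\<omega>. W t \<omega> - W s \<omega>) (normal_density 0 \<sigma>)"
      using W \<open>s < t\<close> st by (simp add: standard_brownian_motion_def \<sigma>_def)
    have E0: "(\<integral>\<omega>. W t \<omega> - W s \<omega> \<partial>M) = 0"
      using normal_distributed_expectation[OF \<sigma>(1) D] by simp
    have "integrable M (\<lambda>\<omega>. (W t \<omega> - W s \<omega>) ^ k)" for k
      using distributed_integrable[OF D, of "\<lambda>x. x ^ k"] integrable_normal_moment[OF \<sigma>(1), of 0 k]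
      by simp
    from this[of 1] this[of 2] E0 normal_distributed_variance[OF \<sigma>(1) D] \<sigma>(2)
    show ?thesis by simp
  qed simp
  then show "integrable M (\<lambda>\<omega>. W t \<omega> - W s \<omega>)" "(\<integral>\<omega>. W t \<omega> - W s \<omega> \<partial>M) = 0"
    "integrable M (\<lambda>\<omega>. (W t \<omega> - W s \<omega>)\<^sup>2)" "(\<integral>\<omega>. (W t \<omega> - W s \<omega>)\<^sup>2 \<partial>M) = t - s"
    by auto
qed

lemma wiener_increments_reversed_process:
  assumes W: "standard_brownian_motion M W"
  shows "wiener_increments M (reversed_process W T) T"
  unfolding wiener_increments_def
proof (intro conjI ballI)
  fix t assume "t \<in> {0..T}"
  then have "W T \<in> borel_measurable M" "W (T - t) \<in> borel_measurable M"
    using W by (auto simp: standard_brownian_motion_def)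
  then show "reversed_process W T t \<in> borel_measurable M"
    unfolding reversed_process_def[abs_def] by simp
next
  fix s t assume st: "s \<in> {0..T}" "t \<in> {0..T}"
  have "integrable M (\<lambda>\<omega>. reversed_process W T t \<omega> - reversed_process W T s \<omega>) \<and>
      (\<integral>\<omega>. reversed_process W T t \<omega> - reversed_process W T s \<omega> \<partial>M) = 0 \<and>
      integrable M (\<lambda>\<omega>. (reversed_process W T t \<omega> - reversed_process W T s \<omega>)\<^sup>2) \<and>
      (\<integral>\<omega>. (reversed_process W T t \<omega> - reversed_process W T s \<omega>)\<^sup>2 \<partial>M) = \<bar>t - s\<bar>"
  proof (cases "s \<le> t")
    case True
    with st brownian_increment[OF W, of "T - t" "T - s"] show ?thesis
      by (simp add: reversed_process_def)
  next
    case False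
    have "reversed_process W T t \<omega> - reversed_process W T s \<omega> = - (W (T - t) \<omega> - W (T - s) \<omega>)" for \<omega>
      by (simp add: reversed_process_def)
    moreover have "integrable M (\<lambda>\<omega>. - (W (T - t) \<omega> - W (T - s) \<omega>))"
      using False st brownian_increment[OF W, of "T - s" "T - t"]
      by (intro integrable_minus) simp
    ultimately show ?thesis
      using False st brownian_increment[OF W, of "T - s" "T - t"]
      by (simp only: power2_minus integral_minus) simp
  qed
  then show "integrable M (\<lambda>\<omega>. reversed_process W T t \<omega> - reversed_process W T s \<omega>)"
    "(\<integral>\<omega>. reversed_process W T t \<omega> - reversed_process W T s \<omega> \<partial>M) = 0"
    "integrable M (\<lambda>\<omega>. (reversed_process W T t \<omega> - reversed_process W T s \<omega>)\<^sup>2)"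
    "(\<integral>\<omega>. (reversed_process W T t \<omega> - reversed_process W T s \<omega>)\<^sup>2 \<partial>M) = \<bar>t - s\<bar>"
    by auto
qed

text \<open>
  Polarization writes the product of two increments as a combination of four squared increments,
  whose expectations are distances. The combination
  \<open>(\<bar>d - a\<bar> + \<bar>c - b\<bar> - \<bar>c - a\<bar> - \<bar>d - b\<bar>) / 2\<close> is the length of the overlap.
\<close>

lemma wiener_increments_covariance:
  assumes B: "wiener_increments M B T"
    and ab: "0 \<le> a" "a \<le> b" "b \<le> T" and cd: "0 \<le> c" "c \<le> d" "d \<le> T"
  shows "integrable M (\<lambda>\<omega>. (B b \<omega> - B a \<omega>) * (B d \<omega> - B c \<omega>))"
    and "(\<integral>\<omega>. (B b \<omega> - B a \<omega>) * (B d \<omega> - B c \<omega>) \<partial>M)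
           = (\<integral>z. indicator {a<..b} z * indicator {c<..d} z \<partial>lborel)"
proof -
  have measure_Ioc: "measure lborel {l<..u} = max 0 (u - l)" for l u :: real
    by (cases "l \<le> u") auto
  have polar: "(B b \<omega> - B a \<omega>) * (B d \<omega> - B c \<omega>) =
      ((B d \<omega> - B a \<omega>)\<^sup>2 + (B c \<omega> - B b \<omega>)\<^sup>2 - (B c \<omega> - B a \<omega>)\<^sup>2 - (B d \<omega> - B b \<omega>)\<^sup>2) / 2" for \<omega>
    by (simp add: power2_eq_square field_simps)
  have I: "integrable M (\<lambda>\<omega>. (B t \<omega> - B s \<omega>)\<^sup>2)" "(\<integral>\<omega>. (B t \<omega> - B s \<omega>)\<^sup>2 \<partial>M) = \<bar>t - s\<bar>"
    if "s \<in> {0..T}" "t \<in> {0..T}" for s t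
    using B that by (auto simp: wiener_increments_def)
  have in_T: "a \<in> {0..T}" "b \<in> {0..T}" "c \<in> {0..T}" "d \<in> {0..T}"
    using ab cd by auto
  show "integrable M (\<lambda>\<omega>. (B b \<omega> - B a \<omega>) * (B d \<omega> - B c \<omega>))"
    unfolding polar using in_T by (simp add: I)
  have "(\<integral>\<omega>. (B b \<omega> - B a \<omega>) * (B d \<omega> - B c \<omega>) \<partial>M)
      = (\<bar>d - a\<bar> + \<bar>c - b\<bar> - \<bar>c - a\<bar> - \<bar>d - b\<bar>) / 2"
    unfolding polar using in_T by (simp add: I)
  also have "\<dots> = max 0 (min b d - max a c)"
    using ab cd by (auto simp: max_def min_def abs_if)
  also have "\<dots> = measure lborel {max a c<..min b d}"
    by (rule measure_Ioc[symmetric])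
  also have "\<dots> = (\<integral>z. indicator {a<..b} z * indicator {c<..d} z \<partial>lborel)"
    by (simp add: indicator_inter_arith[symmetric] Int_greaterThanAtMost)
  finally show "(\<integral>\<omega>. (B b \<omega> - B a \<omega>) * (B d \<omega> - B c \<omega>) \<partial>M)
      = (\<integral>z. indicator {a<..b} z * indicator {c<..d} z \<partial>lborel)" .
qed

lemma is_subdivision_mono:
  assumes "is_subdivision T n p" "i \<le> j" "j \<le> n"
  shows "p i \<le> p j"
  using assms(2,3)
proof (induction j rule: dec_induct)
  case (step j)
  with assms(1) have "p j \<le> p (Suc j)"
    by (simp add: is_subdivision_def)
  with step show ?case by simp
qed simp

lemma is_subdivision_range:
  assumes "is_subdivision T n p" "i \<le> n"
  shows "0 \<le> p i" "p i \<le> T"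
  using is_subdivision_mono[OF assms(1), of 0 i] is_subdivision_mono[OF assms(1), of i n] assms
  by (auto simp: is_subdivision_def)

lemma step_fun_measurable[measurable]: "step_fun n p c \<in> borel_measurable borel"
  unfolding step_fun_def[abs_def] by measurable

lemma step_integral_measurable:
  assumes B: "wiener_increments M B T" and p: "is_subdivision T n p"
  shows "step_integral B n p c \<in> borel_measurable M"
proof -
  have "B (p i) \<in> borel_measurable M" if "i \<le> n" for i
    using B is_subdivision_range[OF p that] by (auto simp: wiener_increments_def)
  then show ?thesis
    unfolding step_integral_def[abs_def]
    by (intro borel_measurable_sum borel_measurable_times borel_measurable_diff borel_measurable_const) auto
qed

lemma expectation_step_integral:
  assumes B: "wiener_increments M B T" and p: "is_subdivision T n p"
  shows "integrable M (step_integral B n p c)" "(\<integral>\<omega>. step_integral B n p c \<omega> \<partial>M) = 0"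
proof -
  have "integrable M (\<lambda>\<omega>. B (p (Suc i)) \<omega> - B (p i) \<omega>)"
       "(\<integral>\<omega>. B (p (Suc i)) \<omega> - B (p i) \<omega> \<partial>M) = 0" if "i < n" for i
    using B is_subdivision_range[OF p, of i] is_subdivision_range[OF p, of "Suc i"] that
    by (auto simp: wiener_increments_def)
  then show "integrable M (step_integral B n p c)" "(\<integral>\<omega>. step_integral B n p c \<omega> \<partial>M) = 0"
    unfolding step_integral_def[abs_def]
    by (auto intro!: Bochner_Integration.integrable_sum integrable_mult_right
          simp: Bochner_Integration.integral_sum)
qed

lemma integrable_indicator_Ioc_product:
  "integrable lborel (\<lambda>z::real. indicator {a<..b} z * indicator {c<..d} z :: real)"
proof -
  have "{max a c<..min b d} \<subseteq> {a..b}" by auto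
  then have "emeasure lborel {max a c<..min b d} \<le> emeasure lborel {a..b}"
    by (rule emeasure_mono) simp
  also have "\<dots> < \<infinity>"
    by (simp add: emeasure_lborel_Icc_eq)
  finally show ?thesis
    by (simp add: indicator_inter_arith[symmetric] Int_greaterThanAtMost)
qed

lemma integral_double_sum:
  fixes g :: "nat \<Rightarrow> nat \<Rightarrow> 'a \<Rightarrow> real"
  assumes "\<And>i j. i < n \<Longrightarrow> j < m \<Longrightarrow> integrable M (g i j)"
  shows "(\<integral>x. (\<Sum>i<n. \<Sum>j<m. a i j * g i j x) \<partial>M) = (\<Sum>i<n. \<Sum>j<m. a i j * (\<integral>x. g i j x \<partial>M))"
proof -
  have "(\<integral>x. (\<Sum>i<n. \<Sum>j<m. a i j * g i j x) \<partial>M) = (\<Sum>i<n. \<integral>x. (\<Sum>j<m. a i j * g i j x) \<partial>M)"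
    using assms
    by (intro Bochner_Integration.integral_sum Bochner_Integration.integrable_sum integrable_mult_right) auto
  also have "\<dots> = (\<Sum>i<n. \<Sum>j<m. \<integral>x. a i j * g i j x \<partial>M)"
    using assms
    by (intro sum.cong refl Bochner_Integration.integral_sum integrable_mult_right) auto
  finally show ?thesis by simp
qed

text \<open>
  Both sides are bilinear, so the covariance of two increments suffices; the two subdivisions are
  arbitrary.
\<close>

lemma step_integral_inner_product:
  assumes B: "wiener_increments M B T" and p: "is_subdivision T n p" and q: "is_subdivision T m q"
  shows "integrable M (\<lambda>\<omega>. step_integral B n p c \<omega> * step_integral B m q d \<omega>)"
    and "integrable lborel (\<lambda>z. step_fun n p c z * step_fun m q d z)"
    and "(\<integral>\<omega>. step_integral B n p c \<omega> * step_integral B m q d \<omega> \<partial>M)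
           = (\<integral>z. step_fun n p c z * step_fun m q d z \<partial>lborel)"
proof -
  let ?D = "\<lambda>i j \<omega>. (B (p (Suc i)) \<omega> - B (p i) \<omega>) * (B (q (Suc j)) \<omega> - B (q j) \<omega>)"
  let ?I = "\<lambda>i j z. indicator {p i<..p (Suc i)} z * indicator {q j<..q (Suc j)} z :: real"
  have S: "step_integral B n p c \<omega> * step_integral B m q d \<omega> = (\<Sum>i<n. \<Sum>j<m. (c i * d j) * ?D i j \<omega>)" for \<omega>
    unfolding step_integral_def sum_product by (simp add: ac_simps)
  have F: "step_fun n p c z * step_fun m q d z = (\<Sum>i<n. \<Sum>j<m. (c i * d j) * ?I i j z)" for z
    unfolding step_fun_def sum_product by (simp add: ac_simps)
  have cov: "integrable M (?D i j)" "(\<integral>\<omega>. ?D i j \<omega> \<partial>M) = (\<integral>z. ?I i j z \<partial>lborel)"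
    if "i < n" "j < m" for i j
    using that is_subdivision_range[OF p, of i] is_subdivision_range[OF p, of "Suc i"]
      is_subdivision_range[OF q, of j] is_subdivision_range[OF q, of "Suc j"]
      is_subdivision_mono[OF p, of i "Suc i"] is_subdivision_mono[OF q, of j "Suc j"]
      wiener_increments_covariance[OF B, of "p i" "p (Suc i)" "q j" "q (Suc j)"]
    by auto
  show "integrable M (\<lambda>\<omega>. step_integral B n p c \<omega> * step_integral B m q d \<omega>)"
    unfolding S using cov(1)
    by (intro Bochner_Integration.integrable_sum integrable_mult_right) auto
  show "integrable lborel (\<lambda>z. step_fun n p c z * step_fun m q d z)"
    unfolding F
    by (intro Bochner_Integration.integrable_sum integrable_mult_right integrable_indicator_Ioc_product)
  have "(\<integral>\<omega>. step_integral B n p c \<omega> * step_integral B m q d \<omega> \<partial>M)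
      = (\<Sum>i<n. \<Sum>j<m. (c i * d j) * (\<integral>\<omega>. ?D i j \<omega> \<partial>M))"
    unfolding S using cov(1) by (intro integral_double_sum) auto
  also have "\<dots> = (\<Sum>i<n. \<Sum>j<m. (c i * d j) * (\<integral>z. ?I i j z \<partial>lborel))"
    using cov(2) by simp
  also have "\<dots> = (\<integral>z. step_fun n p c z * step_fun m q d z \<partial>lborel)"
    unfolding F by (intro integral_double_sum[symmetric] integrable_indicator_Ioc_product)
  finally show "(\<integral>\<omega>. step_integral B n p c \<omega> * step_integral B m q d \<omega> \<partial>M)
      = (\<integral>z. step_fun n p c z * step_fun m q d z \<partial>lborel)" .
qed

lemma step_integral_isometry:
  assumes B: "wiener_increments M B T" and p: "is_subdivision T n p" and q: "is_subdivision T m q"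
  shows "(\<integral>\<^sup>+\<omega>. ennreal ((step_integral B n p c \<omega> - step_integral B m q d \<omega>)\<^sup>2) \<partial>M)
       = (\<integral>\<^sup>+z. ennreal ((step_fun n p c z - step_fun m q d z)\<^sup>2) \<partial>lborel)"
proof -
  have sq: "(x - y)\<^sup>2 = x * x - 2 * (x * y) + y * y" for x y :: real
    by (simp add: power2_eq_square algebra_simps)
  note P = step_integral_inner_product[OF B]
  have "integrable M (\<lambda>\<omega>. (step_integral B n p c \<omega> - step_integral B m q d \<omega>)\<^sup>2)"
    unfolding sq by (intro Bochner_Integration.integrable_add Bochner_Integration.integrable_diff integrable_mult_right P p q)
  moreover have "integrable lborel (\<lambda>z. (step_fun n p c z - step_fun m q d z)\<^sup>2)"
    unfolding sq by (intro Bochner_Integration.integrable_add Bochner_Integration.integrable_diff integrable_mult_right P[OF _ _] p q)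
  moreover have "(\<integral>\<omega>. (step_integral B n p c \<omega> - step_integral B m q d \<omega>)\<^sup>2 \<partial>M)
      = (\<integral>z. (step_fun n p c z - step_fun m q d z)\<^sup>2 \<partial>lborel)"
    unfolding sq by (simp add: P[OF p p] P[OF p q] P[OF q q])
  ultimately show ?thesis
    by (simp add: nn_integral_eq_integral)
qed

lemma step_fun_eq:
  assumes p: "is_subdivision T n p" and i: "i < n" "z \<in> {p i<..p (Suc i)}"
  shows "step_fun n p c z = c i"
proof -
  have "indicator {p j<..p (Suc j)} z = (if j = i then 1 else 0 :: real)" if "j < n" for j
  proof (cases j i rule: linorder_cases)
    case less
    with is_subdivision_mono[OF p, of "Suc j" i] i show ?thesis by auto
  next
    case greater
    with is_subdivision_mono[OF p, of "Suc i" j] i that show ?thesis by auto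
  qed (use i in auto)
  then have "step_fun n p c z = (\<Sum>j<n. if j = i then c j else 0)"
    unfolding step_fun_def by (intro sum.cong) auto
  also have "\<dots> = c i"
    using i by simp
  finally show ?thesis .
qed

text \<open>
  The first subdivision point that reaches \<open>z\<close> is the right end of its piece.
\<close>

lemma is_subdivision_covers:
  assumes p: "is_subdivision T n p" and z: "0 < z" "z \<le> T"
  obtains i where "i < n" "z \<in> {p i<..p (Suc i)}"
proof -
  define i where "i = (LEAST i. z \<le> p i)"
  have "z \<le> p n"
    using p z by (simp add: is_subdivision_def)
  then have i: "z \<le> p i" "i \<le> n"
    unfolding i_def by (auto intro: LeastI Least_le)
  then have "i \<noteq> 0"
    using p z by (metis is_subdivision_def not_le)
  then obtain j where j: "i = Suc j"
    using not0_implies_Suc by blast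
  then have "p j < z"
    using not_less_Least[of j "\<lambda>i. z \<le> p i"] by (simp add: i_def[symmetric] not_le)
  with i j show thesis
    by (intro that[of j]) auto
qed

lemma step_fun_outside:
  assumes p: "is_subdivision T n p" and z: "z \<notin> {0..T}"
  shows "step_fun n p c z = 0"
  unfolding step_fun_def
proof (rule sum.neutral, rule ballI)
  fix i assume "i \<in> {..<n}"
  then have "0 \<le> p i" "p (Suc i) \<le> T"
    using is_subdivision_range[OF p, of i] is_subdivision_range[OF p, of "Suc i"] by auto
  then show "c i * indicator {p i<..p (Suc i)} z = 0"
    using z by (auto simp: indicator_def)
qed

section \<open>The Wiener integral and its variance\<close>

text \<open>
  Moves the restriction to \<open>[0, T]\<close> from the domain of integration into the integrand, where
  \<open>tendsto_integral_square\<close> and the isometry of step integrals apply.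
\<close>

lemma step_approx_error_eq:
  assumes p: "is_subdivision T n p"
  shows "(\<integral>\<^sup>+z\<in>{0..T}. ennreal ((f z - step_fun n p c z)\<^sup>2) \<partial>lborel)
       = (\<integral>\<^sup>+z. ennreal ((indicator {0..T} z * f z - step_fun n p c z)\<^sup>2) \<partial>lborel)"
  using step_fun_outside[OF p] by (intro nn_integral_cong) (auto simp: indicator_def)

text \<open>
  The first two moments of \<open>J\<close> are the limits of those of its step integrals, whichever
  approximating sequence witnesses that \<open>J\<close> is an integral. Hence the choice of a version in
  \<open>wiener_integral\<close> does not affect the variance.
\<close>

lemma variance_has_wiener_integral:
  assumes M: "prob_space M" and B: "wiener_increments M B T"
    and J: "has_wiener_integral M B T f J"
  shows "prob_space.variance M J = (LINT z:{0..T}|lborel. (f z)\<^sup>2)"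
proof -
  interpret prob_space M by (rule M)
  from J obtain n p c where
    f: "set_borel_measurable lborel {0..T} f" and Jm[measurable]: "J \<in> borel_measurable M"
    and p: "\<And>k. is_subdivision T (n k) (p k)"
    and flim: "(\<lambda>k::nat. \<integral>\<^sup>+z\<in>{0..T}. ennreal ((f z - step_fun (n k) (p k) (c k) z)\<^sup>2) \<partial>lborel) \<longlonglongrightarrow> 0"
    and Jlim: "(\<lambda>k. \<integral>\<^sup>+\<omega>. ennreal ((J \<omega> - step_integral B (n k) (p k) (c k) \<omega>)\<^sup>2) \<partial>M) \<longlonglongrightarrow> 0"
    unfolding has_wiener_integral_def by blast
  define h where "h z = indicator {0..T} z * f z" for z
  have h[measurable]: "h \<in> borel_measurable lborel"
    using f unfolding set_borel_measurable_def h_def[abs_def] by simp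
  define S where "S k = step_integral B (n k) (p k) (c k)" for k
  define s where "s k = step_fun (n k) (p k) (c k)" for k
  have [measurable]: "S k \<in> borel_measurable M" "s k \<in> borel_measurable lborel" for k
    using step_integral_measurable[OF B p] by (auto simp: S_def s_def)
  have S2: "integrable M (\<lambda>\<omega>. (S k \<omega>)\<^sup>2)" "integrable lborel (\<lambda>z. (s k z)\<^sup>2)"
    "(\<integral>\<omega>. (S k \<omega>)\<^sup>2 \<partial>M) = (\<integral>z. (s k z)\<^sup>2 \<partial>lborel)" for k
    unfolding power2_eq_square S_def s_def by (rule step_integral_inner_product[OF B p p])+
  have S1: "integrable M (S k)" "(\<integral>\<omega>. S k \<omega> \<partial>M) = 0" for k
    unfolding S_def by (rule expectation_step_integral[OF B p])+
  have flim': "(\<lambda>k. \<integral>\<^sup>+z. ennreal ((h z - s k z)\<^sup>2) \<partial>lborel) \<longlonglongrightarrow> 0"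
    using flim unfolding step_approx_error_eq[OF p] h_def s_def .
  note LJ = tendsto_integral_square[of J M S, OF _ _ S2(1) Jlim[folded S_def]]
  have J2: "integrable M (\<lambda>\<omega>. (J \<omega>)\<^sup>2)"
    by (rule LJ) auto
  have d2: "integrable M (\<lambda>\<omega>. (J \<omega> - S k \<omega>)\<^sup>2)" for k
    by (rule LJ) auto
  have dlim: "(\<lambda>k. \<integral>\<omega>. (J \<omega> - S k \<omega>)\<^sup>2 \<partial>M) \<longlonglongrightarrow> 0"
    by (rule LJ) auto
  have EJ2: "(\<integral>\<omega>. (J \<omega>)\<^sup>2 \<partial>M) = (\<integral>z. (h z)\<^sup>2 \<partial>lborel)"
  proof (rule LIMSEQ_unique)
    show "(\<lambda>k. \<integral>\<omega>. (S k \<omega>)\<^sup>2 \<partial>M) \<longlonglongrightarrow> (\<integral>\<omega>. (J \<omega>)\<^sup>2 \<partial>M)"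
      by (rule LJ) auto
    show "(\<lambda>k. \<integral>\<omega>. (S k \<omega>)\<^sup>2 \<partial>M) \<longlonglongrightarrow> (\<integral>z. (h z)\<^sup>2 \<partial>lborel)"
      unfolding S2(3) by (rule tendsto_integral_square[OF _ _ S2(2) flim']) auto
  qed
  have J1: "integrable M J"
    by (rule square_integrable_imp_integrable[OF _ J2]) simp
  \<comment> \<open>\<open>(E J)\<^sup>2 = (E (J - S k))\<^sup>2 \<le> E (J - S k)\<^sup>2\<close>, since step integrals are centred\<close>
  have "expectation J = 0"
  proof -
    have "(expectation J)\<^sup>2 \<le> (\<integral>\<omega>. (J \<omega> - S k \<omega>)\<^sup>2 \<partial>M)" for k
    proof -
      have J_S: "integrable M (\<lambda>\<omega>. J \<omega> - S k \<omega>)"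
        using J1 S1(1) by simp
      have "expectation J = expectation (\<lambda>\<omega>. J \<omega> - S k \<omega>)"
        using J1 S1[of k] by simp
      moreover have "(expectation (\<lambda>\<omega>. J \<omega> - S k \<omega>))\<^sup>2 \<le> (\<integral>\<omega>. (J \<omega> - S k \<omega>)\<^sup>2 \<partial>M)"
        using variance_eq[OF J_S d2] variance_positive[of "\<lambda>\<omega>. J \<omega> - S k \<omega>"] by linarith
      ultimately show ?thesis
        by (simp only:)
    qed
    then have "(expectation J)\<^sup>2 \<le> 0"
      by (intro LIMSEQ_le_const[OF dlim]) auto
    then show ?thesis by simp
  qed
  then have "variance J = (\<integral>z. (h z)\<^sup>2 \<partial>lborel)"
    using EJ2 by simp
  also have "\<dots> = (LINT z:{0..T}|lborel. (f z)\<^sup>2)"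
    unfolding set_lebesgue_integral_def h_def
    by (intro Bochner_Integration.integral_cong) (auto simp: indicator_def)
  finally show ?thesis .
qed

text \<open>
  The step functions on the uniform subdivisions that take the value of \<open>f\<close> at the right end of each
  piece converge to \<open>f\<close> pointwise on \<open>(0, T]\<close>, hence in \<open>L\<^sup>2\<close> by dominated convergence. By the
  isometry their integrals form a Cauchy sequence. The interval is half-open because the argument of
  the kernel of the Conga line is singular at 0.
\<close>

lemma ex_has_wiener_integral:
  assumes B: "wiener_increments M B T" and T: "0 \<le> T"
    and f: "set_borel_measurable lborel {0..T} f"
    and cont: "continuous_on {0<..T} f" and bdd: "\<And>z. 0 < z \<Longrightarrow> z \<le> T \<Longrightarrow> \<bar>f z\<bar> \<le> C"
  shows "\<exists>J. has_wiener_integral M B T f J"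
proof -
  define p where "p k i = T * real i / real (Suc k)" for k i :: nat
  define c where "c k i = f (p k (Suc i))" for k i
  define s where "s k = step_fun (Suc k) (p k) (c k)" for k
  define S where "S k = step_integral B (Suc k) (p k) (c k)" for k
  have p: "is_subdivision T (Suc k) (p k)" for k
    using T by (auto simp: is_subdivision_def p_def divide_right_mono mult_left_mono)
  define h where "h z = indicator {0..T} z * f z" for z
  have h[measurable]: "h \<in> borel_measurable lborel"
    using f unfolding set_borel_measurable_def h_def[abs_def] by simp
  have [measurable]: "s k \<in> borel_measurable lborel" for k
    by (simp add: s_def)
  have [measurable]: "S k \<in> borel_measurable M" for k
    unfolding S_def by (rule step_integral_measurable[OF B p])
  \<comment> \<open>the step function takes at \<open>z\<close> the value of \<open>f\<close> at the next subdivision point\<close>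
  have s_val: "\<exists>y\<in>{z..min T (z + T / real (Suc k))}. s k z = f y" if z: "0 < z" "z \<le> T" for k z
  proof -
    obtain i where i: "i < Suc k" "z \<in> {p k i<..p k (Suc i)}"
      using is_subdivision_covers[OF p z] .
    have "p k (Suc i) = p k i + T / real (Suc k)"
      by (simp add: p_def add_divide_distrib distrib_left)
    moreover have "p k (Suc i) \<le> T"
      using is_subdivision_range(2)[OF p, of "Suc i" k] i(1) by simp
    moreover have "s k z = f (p k (Suc i))"
      using step_fun_eq[OF p i] by (simp add: s_def c_def)
    ultimately show ?thesis
      using i by (intro bexI[of _ "p k (Suc i)"]) auto
  qed
  have lim: "(\<lambda>k. s k z) \<longlonglongrightarrow> f z" if z: "0 < z" "z \<le> T" for z
  proof -
    have "\<forall>k. \<exists>y. y \<in> {z..min T (z + T / real (Suc k))} \<and> s k z = f y"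
      using s_val[OF z] by blast
    then obtain y where y: "\<And>k. y k \<in> {z..min T (z + T / real (Suc k))}" "\<And>k. s k z = f (y k)"
      by metis
    have "y \<longlonglongrightarrow> z"
    proof (rule tendsto_sandwich[OF _ _ tendsto_const])
      have "(\<lambda>k. z + T * inverse (real (Suc k))) \<longlonglongrightarrow> z + T * 0"
        by (intro tendsto_intros LIMSEQ_inverse_real_of_nat)
      then show "(\<lambda>k. z + T / real (Suc k)) \<longlonglongrightarrow> z"
        by (simp add: divide_inverse)
    qed (use y(1) in auto)
    moreover have "\<forall>\<^sub>F k in sequentially. y k \<in> {0<..T}"
    proof (rule always_eventually, rule allI)
      show "y k \<in> {0<..T}" for k
        using y(1)[of k] z by auto
    qed
    ultimately have "(\<lambda>k. f (y k)) \<longlonglongrightarrow> f z"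
      using z by (intro continuous_on_tendsto_compose[OF cont]) auto
    then show ?thesis by (simp add: y(2))
  qed
  define a where "a k = (\<integral>\<^sup>+z. ennreal ((h z - s k z)\<^sup>2) \<partial>lborel)" for k
  define w where "w z = ennreal (4 * C\<^sup>2) * indicator {0..T} z" for z :: real
  have nz: "AE z::real in lborel. z \<noteq> 0"
    by (rule AE_lborel_singleton)
  have dom: "AE z in lborel. ennreal ((h z - s k z)\<^sup>2) \<le> w z" for k
    using nz
  proof eventually_elim
    case (elim z)
    show ?case
    proof (cases "z \<in> {0..T}")
      case True
      with elim have z: "0 < z" "z \<le> T" by auto
      then obtain y where "y \<in> {z..min T (z + T / real (Suc k))}" and sy: "s k z = f y"
        using s_val[OF z] by blast
      then have "\<bar>f y\<bar> \<le> C"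
        using z by (intro bdd) auto
      with bdd[OF z] sy True have "\<bar>h z - s k z\<bar> \<le> 2 * C"
        by (simp add: h_def)
      then have "(h z - s k z)\<^sup>2 \<le> (2 * C)\<^sup>2"
        by (rule power2_le_iff_abs_le[THEN iffD2, rotated]) (use bdd[OF z] in auto)
      then show ?thesis
        using True by (simp add: w_def power_mult_distrib ennreal_leI)
    next
      case False
      then show ?thesis
        using step_fun_outside[OF p False] by (simp add: h_def s_def)
    qed
  qed
  have wfin: "(\<integral>\<^sup>+z. w z \<partial>lborel) < \<infinity>"
    unfolding w_def using T by (simp add: nn_integral_cmult ennreal_mult_less_top)
  have "a \<longlonglongrightarrow> (\<integral>\<^sup>+z. 0 \<partial>(lborel :: real measure))"
    unfolding a_def[abs_def]
  proof (rule nn_integral_dominated_convergence[OF _ _ _ dom wfin])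
    show "AE z in lborel. (\<lambda>k. ennreal ((h z - s k z)\<^sup>2)) \<longlonglongrightarrow> 0"
      using nz
    proof eventually_elim
      case (elim z)
      show ?case
      proof (cases "z \<in> {0..T}")
        case True
        with elim have "(\<lambda>k. s k z) \<longlonglongrightarrow> h z"
          using lim[of z] by (simp add: h_def)
        then have "(\<lambda>k. ennreal ((h z - s k z)\<^sup>2)) \<longlonglongrightarrow> ennreal ((h z - h z)\<^sup>2)"
          by (intro tendsto_ennrealI tendsto_intros)
        then show ?thesis by simp
      next
        case False
        then show ?thesis
          using step_fun_outside[OF p False] by (simp add: h_def s_def)
      qed
    qed
  qed (auto simp: w_def)
  then have a0: "a \<longlonglongrightarrow> 0" by simp
  have afin: "a k < \<infinity>" for k
    unfolding a_def using nn_integral_mono_AE[OF dom] wfin by (rule le_less_trans)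
  define e where "e k = 2 * enn2real (a k)" for k
  have ae: "ennreal (e k) = 2 * a k" for k
    using afin[of k] by (simp add: e_def ennreal_mult)
  have e0: "e \<longlonglongrightarrow> 0"
    unfolding e_def[abs_def] using tendsto_mult_right_zero[OF tendsto_enn2real[of a 0]] a0 by simp
  have cauchy: "(\<integral>\<^sup>+\<omega>. ennreal ((S m \<omega> - S n \<omega>)\<^sup>2) \<partial>M) \<le> ennreal (e m + e n)" for m n
  proof -
    have "(\<integral>\<^sup>+\<omega>. ennreal ((S m \<omega> - S n \<omega>)\<^sup>2) \<partial>M) = (\<integral>\<^sup>+z. ennreal ((s m z - s n z)\<^sup>2) \<partial>lborel)"
      unfolding S_def s_def by (rule step_integral_isometry[OF B p p])
    also have "\<dots> \<le> (\<integral>\<^sup>+z. 2 * ennreal ((h z - s m z)\<^sup>2) + 2 * ennreal ((h z - s n z)\<^sup>2) \<partial>lborel)"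
    proof (rule nn_integral_mono)
      fix z
      have "(x - y)\<^sup>2 \<le> 2 * (u - x)\<^sup>2 + 2 * (u - y)\<^sup>2" for x y u :: real
        using zero_le_power2[of "(u - x) + (u - y)"] by (simp add: power2_eq_square algebra_simps)
      then have "ennreal ((s m z - s n z)\<^sup>2) \<le> ennreal (2 * (h z - s m z)\<^sup>2 + 2 * (h z - s n z)\<^sup>2)"
        by (rule ennreal_leI)
      then show "ennreal ((s m z - s n z)\<^sup>2) \<le> 2 * ennreal ((h z - s m z)\<^sup>2) + 2 * ennreal ((h z - s n z)\<^sup>2)"
        by (simp add: ennreal_mult)
    qed
    also have "\<dots> = 2 * a m + 2 * a n"
      unfolding a_def by (simp add: nn_integral_add nn_integral_cmult)
    also have "\<dots> = ennreal (e m + e n)"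
      using ae[of m] ae[of n] by (simp add: e_def)
    finally show ?thesis .
  qed
  obtain J where J: "J \<in> borel_measurable M"
    "\<And>k. (\<integral>\<^sup>+\<omega>. ennreal ((J \<omega> - S k \<omega>)\<^sup>2) \<partial>M) \<le> ennreal (e k)"
    using L2_complete[of S M e, OF _ e0 _ cauchy] by (auto simp: e_def)
  have Jlim: "(\<lambda>k. \<integral>\<^sup>+\<omega>. ennreal ((J \<omega> - S k \<omega>)\<^sup>2) \<partial>M) \<longlonglongrightarrow> 0"
  proof (rule tendsto_sandwich[OF _ _ tendsto_const])
    show "(\<lambda>k. ennreal (e k)) \<longlonglongrightarrow> 0"
      using tendsto_ennrealI[OF e0] by simp
  qed (use J(2) in auto)
  have "has_wiener_integral M B T f J"
    unfolding has_wiener_integral_def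
    using f J(1) p Jlim[unfolded S_def] a0[unfolded a_def[abs_def] h_def s_def, folded step_approx_error_eq[OF p]]
    by (intro conjI exI[of _ "\<lambda>k. Suc k"] exI[of _ p] exI[of _ c]) auto
  then show ?thesis by (intro exI[of _ J])
qed

lemma variance_wiener_integral:
  assumes "prob_space M" "wiener_increments M B T" "0 \<le> T"
    and "set_borel_measurable lborel {0..T} f" "continuous_on {0<..T} f"
    and "\<And>z. 0 < z \<Longrightarrow> z \<le> T \<Longrightarrow> \<bar>f z\<bar> \<le> C"
  shows "prob_space.variance M (wiener_integral M B T f) = (LINT z:{0..T}|lborel. (f z)\<^sup>2)"
proof (rule variance_has_wiener_integral)
  show "has_wiener_integral M B T f (wiener_integral M B T f)"
    unfolding wiener_integral_def using ex_has_wiener_integral[OF assms(2-6)] by (rule someI_ex)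
qed fact+

section \<open>The tail of the normal distribution\<close>

interpretation std_normal: real_distribution std_normal_distribution
  by (rule real_dist_normal_dist)

lemma std_normal_tail_eq: "std_normal_tail y = measure std_normal_distribution {y<..}"
proof -
  have "{y<..} = space std_normal_distribution - {..y}"
    by auto
  then show ?thesis
    using std_normal.prob_compl[of "{..y}"] by (simp add: std_normal_tail_def cdf_def)
qed

lemma ennreal_std_normal_tail:
  "ennreal (std_normal_tail y) = (\<integral>\<^sup>+u. ennreal (std_normal_density u) * indicator {y<..} u \<partial>lborel)"
  unfolding std_normal_tail_eq std_normal.emeasure_eq_measure[symmetric]
  by (simp add: emeasure_density)

lemma std_normal_tail_antimono: "x \<le> y \<Longrightarrow> std_normal_tail y \<le> std_normal_tail x"
  unfolding std_normal_tail_def using std_normal.cdf_nondecreasing by simp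

lemma std_normal_tail_nonneg: "0 \<le> std_normal_tail y"
  unfolding std_normal_tail_eq by simp

lemma std_normal_tail_le_1: "std_normal_tail y \<le> 1"
  unfolding std_normal_tail_eq by simp

lemma isCont_std_normal_tail: "isCont std_normal_tail y"
proof -
  have "emeasure std_normal_distribution {y} = 0"
    by (simp add: emeasure_density nn_integral_indicator_singleton)
  then have "isCont (cdf std_normal_distribution) y"
    by (simp add: std_normal.isCont_cdf measure_def)
  then show ?thesis
    unfolding std_normal_tail_def[abs_def] by (intro continuous_intros)
qed

lemma std_normal_tail_measurable[measurable]: "std_normal_tail \<in> borel_measurable borel"
  using isCont_std_normal_tail
  by (intro borel_measurable_continuous_onI continuous_at_imp_continuous_on) auto

text \<open>
  Mills' bound: insert the factor \<open>u / y \<ge> 1\<close>, after which the density has a primitive.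
\<close>

lemma std_normal_tail_le:
  assumes "0 < y"
  shows "std_normal_tail y \<le> exp (- y\<^sup>2 / 2) / y"
proof -
  have "ennreal (std_normal_tail y) = (\<integral>\<^sup>+u. ennreal (std_normal_density u) * indicator {y<..} u \<partial>lborel)"
    by (rule ennreal_std_normal_tail)
  also have "\<dots> \<le> (\<integral>\<^sup>+u. ennreal (u / y * exp (- u\<^sup>2 / 2)) * indicator {y..} u \<partial>lborel)"
  proof (rule nn_integral_mono)
    fix u
    have "std_normal_density u \<le> u / y * exp (- u\<^sup>2 / 2)" if "y < u"
    proof -
      have "1 \<le> sqrt (2 * pi)"
        using pi_gt3 by (simp add: real_le_rsqrt)
      moreover have "1 \<le> u / y"
        using that assms by simp
      ultimately have "1 / sqrt (2 * pi) \<le> u / y"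
        using order_trans[of "1 / sqrt (2 * pi)" 1 "u / y"] by simp
      then show ?thesis
        unfolding std_normal_density_def by (rule mult_right_mono) simp
    qed
    then show "ennreal (std_normal_density u) * indicator {y<..} u
        \<le> ennreal (u / y * exp (- u\<^sup>2 / 2)) * indicator {y..} u"
      by (auto simp: indicator_def intro!: ennreal_leI)
  qed
  also have "\<dots> = ennreal (0 - (- exp (- y\<^sup>2 / 2) / y))"
  proof (rule nn_integral_FTC_atLeast[where F = "\<lambda>u. - exp (- u\<^sup>2 / 2) / y"])
    show "((\<lambda>u. - exp (- u\<^sup>2 / 2) / y) has_real_derivative u / y * exp (- u\<^sup>2 / 2)) (at u)" for u
      using assms by (auto intro!: derivative_eq_intros simp: field_simps)
    show "((\<lambda>u. - exp (- u\<^sup>2 / 2) / y) \<longlongrightarrow> 0) at_top"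
      using assms by real_asymp
    show "(\<lambda>u. u / y * exp (- u\<^sup>2 / 2)) \<in> borel_measurable borel"
      by measurable
    show "0 \<le> u / y * exp (- u\<^sup>2 / 2)" if "y \<le> u" for u
      using that assms by simp
  qed
  finally have "ennreal (std_normal_tail y) \<le> ennreal (exp (- y\<^sup>2 / 2) / y)"
    by simp
  moreover have "0 \<le> exp (- y\<^sup>2 / 2) / y"
    using assms by simp
  ultimately show ?thesis
    by (simp only: ennreal_le_iff)
qed

text \<open>
  On \<open>(y, y + 1/y]\<close> the exponent \<open>u\<^sup>2 / 2\<close> exceeds \<open>y\<^sup>2 / 2\<close> by at most
  \<open>1 + 1 / (2 y\<^sup>2) \<le> 3/2\<close>, so this interval of length \<open>1 / y\<close> already carries mass of the order of
  Mills' bound.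
\<close>

lemma std_normal_tail_ge:
  assumes "1 \<le> y"
  shows "exp (- 3 / 2) / sqrt (2 * pi) * (exp (- y\<^sup>2 / 2) / y) \<le> std_normal_tail y"
proof -
  define c where "c = exp (- 3 / 2) / sqrt (2 * pi) * exp (- y\<^sup>2 / 2)"
  have c: "0 \<le> c" by (simp add: c_def)
  have "c \<le> std_normal_density u" if "y < u" "u \<le> y + 1 / y" for u
  proof -
    have "u\<^sup>2 \<le> (y + 1 / y)\<^sup>2"
      using that assms by (intro power_mono) auto
    also have "\<dots> = y\<^sup>2 + 2 + (1 / y)\<^sup>2"
      using assms by (simp add: power2_eq_square field_simps)
    also have "(1 / y)\<^sup>2 \<le> 1"
      using assms by (simp add: power_le_one)
    finally have "exp (- 3 / 2 + - y\<^sup>2 / 2) \<le> exp (- u\<^sup>2 / 2)"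
      by simp
    then show ?thesis
      unfolding c_def std_normal_density_def exp_add by (simp add: divide_right_mono)
  qed
  then have "(\<integral>\<^sup>+u. ennreal c * indicator {y<..y + 1 / y} u \<partial>lborel)
      \<le> (\<integral>\<^sup>+u. ennreal (std_normal_density u) * indicator {y<..} u \<partial>lborel)"
    by (intro nn_integral_mono) (auto simp: indicator_def intro!: ennreal_leI)
  also have "\<dots> = ennreal (std_normal_tail y)"
    by (rule ennreal_std_normal_tail[symmetric])
  also have "(\<integral>\<^sup>+u. ennreal c * indicator {y<..y + 1 / y} u \<partial>lborel) = ennreal (c * (1 / y))"
    using assms c by (simp add: nn_integral_cmult_indicator ennreal_mult[symmetric])
  finally show ?thesis
    using std_normal_tail_nonneg by (simp add: c_def ennreal_le_iff)
qed

lemma std_normal_tail_0_pos: "0 < std_normal_tail 0"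
proof -
  have "0 < exp (- 3 / 2) / sqrt (2 * pi) * (exp (- 1\<^sup>2 / 2) / 1)"
    by simp
  also have "\<dots> \<le> std_normal_tail 1"
    using std_normal_tail_ge[of 1] by simp
  also have "\<dots> \<le> std_normal_tail 0"
    by (rule std_normal_tail_antimono) simp
  finally show ?thesis .
qed

text \<open>
  A crude bound that holds for arguments of either sign and has an explicit integral.
\<close>

lemma std_normal_tail_square_le_exp: "(std_normal_tail y)\<^sup>2 \<le> exp (1 - y)"
proof (cases "1 \<le> y")
  case True
  have "std_normal_tail y \<le> exp (- y\<^sup>2 / 2)"
  proof (rule order_trans)
    show "std_normal_tail y \<le> exp (- y\<^sup>2 / 2) / y"
      using True by (intro std_normal_tail_le) simp
    show "exp (- y\<^sup>2 / 2) / y \<le> exp (- y\<^sup>2 / 2)"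
      using True by (simp add: divide_le_eq)
  qed
  then have "(std_normal_tail y)\<^sup>2 \<le> (exp (- y\<^sup>2 / 2))\<^sup>2"
    using std_normal_tail_nonneg by (intro power_mono)
  also have "\<dots> = exp (- y\<^sup>2)"
    by (simp add: exp_double[symmetric])
  also have "\<dots> \<le> exp (1 - y)"
    using self_le_power[OF True, of 2] by simp
  finally show ?thesis .
next
  case False
  have "(std_normal_tail y)\<^sup>2 \<le> 1"
    using std_normal_tail_nonneg std_normal_tail_le_1 by (simp add: power_le_one)
  also have "1 \<le> exp (1 - y)"
    using False by simp
  finally show ?thesis .
qed

section \<open>The variance of the Conga line as an integral\<close>

abbreviation conga_kernel :: "real \<Rightarrow> real \<Rightarrow> real \<Rightarrow> real" where
  "conga_kernel \<alpha> x z \<equiv> std_normal_tail ((x - \<alpha> * z) / (conga_sigma \<alpha> * sqrt z))"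

lemma conga_sigma_pos: "0 < \<alpha> \<Longrightarrow> \<alpha> < 1 \<Longrightarrow> 0 < conga_sigma \<alpha>"
  by (simp add: conga_sigma_def)

lemma variance_conga_line:
  assumes W: "standard_brownian_motion M W" and \<alpha>: "0 < \<alpha>" "\<alpha> < 1" and t: "0 \<le> t"
  shows "prob_space.variance M (conga_line M W \<alpha> x t) = (LINT z:{0..t}|lborel. (conga_kernel \<alpha> x z)\<^sup>2)"
  unfolding conga_line_def
proof (rule variance_wiener_integral[where C = 1])
  show "prob_space M"
    using W by (simp add: standard_brownian_motion_def)
  show "set_borel_measurable lborel {0..t} (conga_kernel \<alpha> x)"
    unfolding set_borel_measurable_def by measurable
  show "continuous_on {0<..t} (conga_kernel \<alpha> x)"
  proof (rule continuous_on_compose2[of UNIV std_normal_tail])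
    show "continuous_on UNIV std_normal_tail"
      using isCont_std_normal_tail by (simp add: continuous_at_imp_continuous_on)
    show "continuous_on {0<..t} (\<lambda>z. (x - \<alpha> * z) / (conga_sigma \<alpha> * sqrt z))"
      using conga_sigma_pos[OF \<alpha>] by (intro continuous_intros) auto
  qed simp
  show "\<bar>conga_kernel \<alpha> x z\<bar> \<le> 1" for z
    by (simp add: std_normal_tail_nonneg std_normal_tail_le_1)
qed (use t wiener_increments_reversed_process[OF W] in blast)+

lemma integrable_indicator_Icc: "integrable lborel (indicat_real {a..b::real})"
  by (rule integrable_real_indicator) (auto simp: emeasure_lborel_Icc_eq)

lemma conga_kernel_square_integrable:
  "set_integrable lborel {0..t} (\<lambda>z. (conga_kernel \<alpha> x z)\<^sup>2)"
proof (rule set_integrable_bound[where f = "\<lambda>_. 1::real"])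
  show "set_integrable lborel {0..t} (\<lambda>_. 1::real)"
    by (simp add: set_integrable_def integrable_indicator_Icc)
  show "set_borel_measurable lborel {0..t} (\<lambda>z. (conga_kernel \<alpha> x z)\<^sup>2)"
    unfolding set_borel_measurable_def by measurable
qed (auto simp: power_le_one std_normal_tail_nonneg std_normal_tail_le_1)

lemma integral_conga_kernel_ge:
  assumes m: "0 \<le> m" and h: "0 \<le> h" "h \<le> t"
    and ge: "\<And>z. t - h \<le> z \<Longrightarrow> z \<le> t \<Longrightarrow> m \<le> conga_kernel \<alpha> x z"
  shows "m\<^sup>2 * h \<le> (LINT z:{0..t}|lborel. (conga_kernel \<alpha> x z)\<^sup>2)"
proof -
  have "m\<^sup>2 * h = (LINT z:{t - h..t}|lborel. m\<^sup>2)"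
    using h by (simp add: set_lebesgue_integral_def)
  also have "\<dots> \<le> (LINT z:{0..t}|lborel. (conga_kernel \<alpha> x z)\<^sup>2)"
    unfolding set_lebesgue_integral_def
  proof (rule integral_mono)
    show "integrable lborel (\<lambda>z. indicator {0..t} z *\<^sub>R (conga_kernel \<alpha> x z)\<^sup>2)"
      using conga_kernel_square_integrable by (simp add: set_integrable_def)
    show "indicator {t - h..t} z *\<^sub>R m\<^sup>2 \<le> indicator {0..t} z *\<^sub>R (conga_kernel \<alpha> x z)\<^sup>2" for z
      using ge[of z] h m by (auto simp: indicator_def intro!: power_mono)
  qed (simp add: integrable_indicator_Icc)
  finally show ?thesis .
qed

text \<open>
  The form of the bound that fits both parts: a plateau of width \<open>s\<close> at the right end of the interval
  and an exponential decay away from this end. The point \<open>z = 0\<close>, where the argument of the kernel is a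
  division by zero, is a null set.
\<close>

lemma integral_conga_kernel_le:
  assumes nn: "0 \<le> A" "0 \<le> s" "0 \<le> D" and k: "0 < k" and t: "0 \<le> t"
    and le: "\<And>z. 0 < z \<Longrightarrow> z \<le> t \<Longrightarrow>
      (conga_kernel \<alpha> x z)\<^sup>2 \<le> A * indicator {t - s..t} z + D * exp (- k * (t - z))"
  shows "(LINT z:{0..t}|lborel. (conga_kernel \<alpha> x z)\<^sup>2) \<le> A * s + D / k"
proof -
  have E: "(\<integral>z. indicator {0..t} z *\<^sub>R (D * exp (- k * (t - z))) \<partial>lborel) = D / k * exp (- k * (t - t)) - D / k * exp (- k * (t - 0))"
    using t k by (intro integral_FTC_atLeastAtMost)
      (auto intro!: derivative_eq_intros continuous_intros simp: has_real_derivative_iff_has_vector_derivative[symmetric])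
  have iE: "integrable lborel (\<lambda>z. indicator {0..t} z *\<^sub>R (D * exp (- k * (t - z))))"
    by (rule borel_integrable_atLeastAtMost'[unfolded set_integrable_def]) (auto intro!: continuous_intros)
  have iA: "integrable lborel (\<lambda>z. A * indicator {t - s..t} z)"
    by (simp add: integrable_indicator_Icc)
  have nz: "AE z::real in lborel. z \<noteq> 0"
    by (rule AE_lborel_singleton)
  have "(LINT z:{0..t}|lborel. (conga_kernel \<alpha> x z)\<^sup>2)
      \<le> (\<integral>z. A * indicator {t - s..t} z + indicator {0..t} z *\<^sub>R (D * exp (- k * (t - z))) \<partial>lborel)"
    unfolding set_lebesgue_integral_def
  proof (rule integral_mono_AE)
    show "integrable lborel (\<lambda>z. indicator {0..t} z *\<^sub>R (conga_kernel \<alpha> x z)\<^sup>2)"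
      using conga_kernel_square_integrable by (simp add: set_integrable_def)
    show "integrable lborel (\<lambda>z. A * indicator {t - s..t} z + indicator {0..t} z *\<^sub>R (D * exp (- k * (t - z))))"
      by (intro Bochner_Integration.integrable_add iA iE)
    show "AE z in lborel. indicator {0..t} z *\<^sub>R (conga_kernel \<alpha> x z)\<^sup>2
        \<le> A * indicator {t - s..t} z + indicator {0..t} z *\<^sub>R (D * exp (- k * (t - z)))"
      using nz
    proof eventually_elim
      case (elim z)
      with le[of z] nn show ?case
        by (cases "z \<in> {0..t}") auto
    qed
  qed
  also have "\<dots> = A * s + (D / k - D / k * exp (- k * t))"
    using nn iE iA E by (subst Bochner_Integration.integral_add) simp_all
  also have "\<dots> \<le> A * s + D / k"
    using nn k by simp
  finally show ?thesis .
qed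

section \<open>Growth orders\<close>

lemma same_orderI:
  assumes g: "\<forall>\<^sub>F t in at_top. 0 < g t" and c: "0 < c"
    and lower: "\<forall>\<^sub>F t in at_top. c * g t \<le> f t" and upper: "\<forall>\<^sub>F t in at_top. f t \<le> C * g t"
  shows "same_order f g"
  unfolding same_order_def
proof (intro conjI exI)
  show pos: "\<forall>\<^sub>F t in at_top. 0 < f t \<and> 0 < g t"
    using g lower
  proof eventually_elim
    case (elim t)
    then have "0 < c * g t" using c by simp
    with elim show ?case by simp
  qed
  show "\<forall>\<^sub>F t in at_top. max (f t / g t) (g t / f t) \<le> max C (1 / c)"
    using pos lower upper
  proof eventually_elim
    case (elim t)
    then have "f t / g t \<le> C" "g t / f t \<le> 1 / c"
      using c by (simp_all add: divide_le_eq pos_divide_le_eq pos_le_divide_eq mult.commute)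
    then show ?case by auto
  qed
qed

text \<open>
  With \<open>m = sqrt l\<close> and \<open>c = \<alpha> / \<sigma>\<close>, the left-hand side is the largest squared argument of the tail
  on \<open>s \<le> sqrt (t / ln t)\<close>. It exceeds the squared argument \<open>l ln t\<close> at \<open>s = 0\<close> by a bounded amount, so that the
  squared tail stays of order \<open>t\<^sup>-\<^sup>l / ln t\<close> on this range.
\<close>

lemma front_argument_square_le:
  fixes m c :: real
  assumes "0 < m" "0 < c"
  obtains K where "0 < K"
    "\<forall>\<^sub>F t in at_top. ((c * sqrt (t / ln t) + m * sqrt (t * ln t)) / sqrt (t - sqrt (t / ln t)))\<^sup>2 \<le> m\<^sup>2 * ln t + K"
proof -
  define l where "l = m\<^sup>2 * (inverse m * c * 2)"
  have "((\<lambda>t. ((c * sqrt (t / ln t) + m * sqrt (t * ln t)) / sqrt (t - sqrt (t / ln t)))\<^sup>2 - m\<^sup>2 * ln t)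
      \<longlongrightarrow> l) at_top"
    unfolding l_def using assms by real_asymp
  then have "\<forall>\<^sub>F t in at_top.
      ((c * sqrt (t / ln t) + m * sqrt (t * ln t)) / sqrt (t - sqrt (t / ln t)))\<^sup>2 - m\<^sup>2 * ln t < l + 1"
    by (rule order_tendstoD) simp
  then have "\<forall>\<^sub>F t in at_top.
      ((c * sqrt (t / ln t) + m * sqrt (t * ln t)) / sqrt (t - sqrt (t / ln t)))\<^sup>2 \<le> m\<^sup>2 * ln t + (l + 1)"
    by eventually_elim simp
  moreover have "0 < l + 1"
    using assms by (simp add: l_def add_pos_pos)
  ultimately show thesis
    by (intro that[of "l + 1"])
qed

text \<open>
  The front \<open>x = \<alpha> t\<close> is where the argument of the tail changes sign at \<open>z = t\<close>. Behind it, the kernel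
  is of order 1 on an interval of length \<open>l t\<^sup>\<beta> / \<alpha>\<close>; beyond twice this length its square
  contributes at most the order of \<open>sqrt t\<close>.
\<close>

lemma same_order_variance_behind_front:
  assumes W: "standard_brownian_motion M W" and \<alpha>: "0 < \<alpha>" "\<alpha> < 1"
    and l: "0 < l" and \<beta>: "1/2 \<le> \<beta>" "\<beta> < 1"
  shows "same_order (\<lambda>t. prob_space.variance M (conga_line M W \<alpha> (\<alpha> * t - l * t powr \<beta>) t))
    (\<lambda>t. t powr \<beta>)"
proof (rule same_orderI)
  define \<sigma> where "\<sigma> = conga_sigma \<alpha>"
  have \<sigma>: "0 < \<sigma>"
    unfolding \<sigma>_def by (rule conga_sigma_pos[OF \<alpha>])
  show "\<forall>\<^sub>F t in at_top. 0 < t powr \<beta>"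
    using eventually_gt_at_top[of 0] by eventually_elim simp
  show "0 < (std_normal_tail 0)\<^sup>2 * (l / \<alpha>)"
    using std_normal_tail_0_pos l \<alpha> by simp
  have "\<forall>\<^sub>F t in at_top. l * t powr \<beta> / \<alpha> < t"
    using l \<alpha> \<beta> by real_asymp
  with eventually_gt_at_top[of 0]
  show "\<forall>\<^sub>F t in at_top. (std_normal_tail 0)\<^sup>2 * (l / \<alpha>) * t powr \<beta>
      \<le> prob_space.variance M (conga_line M W \<alpha> (\<alpha> * t - l * t powr \<beta>) t)"
  proof eventually_elim
    case (elim t)
    have "(std_normal_tail 0)\<^sup>2 * (l * t powr \<beta> / \<alpha>)
        \<le> (LINT z:{0..t}|lborel. (conga_kernel \<alpha> (\<alpha> * t - l * t powr \<beta>) z)\<^sup>2)"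
    proof (rule integral_conga_kernel_ge)
      fix z assume z: "t - l * t powr \<beta> / \<alpha> \<le> z" "z \<le> t"
      have "\<alpha> * t - l * t powr \<beta> = \<alpha> * (t - l * t powr \<beta> / \<alpha>)"
        using \<alpha> by (simp add: field_simps)
      also have "\<dots> \<le> \<alpha> * z"
        using z \<alpha> by (intro mult_left_mono) auto
      finally have "(\<alpha> * t - l * t powr \<beta> - \<alpha> * z) / (conga_sigma \<alpha> * sqrt z) \<le> 0"
        using \<sigma> z elim unfolding \<sigma>_def by (intro divide_nonpos_nonneg) auto
      then show "std_normal_tail 0 \<le> conga_kernel \<alpha> (\<alpha> * t - l * t powr \<beta>) z"
        by (rule std_normal_tail_antimono)
    qed (use elim l \<alpha> std_normal_tail_nonneg in auto)
    then show ?case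
      using elim variance_conga_line[OF W \<alpha>, of t] by simp
  qed
  define C where "C = 2 * l / \<alpha> + 2 * exp 1 * \<sigma> / \<alpha>"
  show "\<forall>\<^sub>F t in at_top. prob_space.variance M (conga_line M W \<alpha> (\<alpha> * t - l * t powr \<beta>) t)
      \<le> C * t powr \<beta>"
    using eventually_ge_at_top[of 1]
  proof eventually_elim
    case (elim t)
    \<comment> \<open>twice the range of nonpositive arguments: beyond it, \<open>\<alpha> s - l t\<^sup>\<beta> \<ge> \<alpha> s / 2\<close>\<close>
    define s where "s = 2 * l * t powr \<beta> / \<alpha>"
    define k where "k = \<alpha> / (2 * \<sigma> * sqrt t)"
    have k: "0 < k"
      using \<alpha> \<sigma> elim by (simp add: k_def)
    have "(LINT z:{0..t}|lborel. (conga_kernel \<alpha> (\<alpha> * t - l * t powr \<beta>) z)\<^sup>2) \<le> 1 * s + exp 1 / k"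
    proof (rule integral_conga_kernel_le)
      fix z assume z: "0 < z" "z \<le> t"
      let ?y = "(\<alpha> * t - l * t powr \<beta> - \<alpha> * z) / (conga_sigma \<alpha> * sqrt z)"
      show "(std_normal_tail ?y)\<^sup>2 \<le> 1 * indicator {t - s..t} z + exp 1 * exp (- k * (t - z))"
      proof (cases "t - s \<le> z")
        case True
        have "(std_normal_tail ?y)\<^sup>2 \<le> 1"
          by (simp add: power_le_one std_normal_tail_nonneg std_normal_tail_le_1)
        also have "\<dots> \<le> 1 * indicator {t - s..t} z + exp 1 * exp (- k * (t - z))"
          using True z by simp
        finally show ?thesis .
      next
        case False
        then have "\<alpha> * s \<le> \<alpha> * (t - z)"
          using \<alpha> by (intro mult_left_mono) auto
        moreover have "\<alpha> * s = 2 * (l * t powr \<beta>)"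
          using \<alpha> by (simp add: s_def)
        ultimately have "\<alpha> * (t - z) / 2 \<le> \<alpha> * (t - z) - l * t powr \<beta>"
          by simp
        then have num: "\<alpha> * (t - z) / 2 \<le> \<alpha> * t - l * t powr \<beta> - \<alpha> * z"
          by (simp add: right_diff_distrib)
        have "0 \<le> \<alpha> * (t - z) / 2"
          using z \<alpha> by simp
        then have nonneg: "0 \<le> \<alpha> * t - l * t powr \<beta> - \<alpha> * z"
          using num by (rule order_trans)
        have "k * (t - z) = (\<alpha> * (t - z) / 2) / (\<sigma> * sqrt t)"
          by (simp add: k_def field_simps)
        also have "\<dots> \<le> ?y"
          unfolding \<sigma>_def[symmetric]
          using z \<sigma> by (intro frac_le nonneg num mult_left_mono) auto
        finally have "exp (1 - ?y) \<le> exp 1 * exp (- k * (t - z))"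
          by (simp add: mult_exp_exp)
        with std_normal_tail_square_le_exp[of ?y]
        have "(std_normal_tail ?y)\<^sup>2 \<le> exp 1 * exp (- k * (t - z))"
          by (rule order_trans)
        then show ?thesis
          by (simp add: indicator_def)
      qed
    qed (use k elim l \<alpha> in \<open>auto simp: s_def\<close>)
    also have "1 * s + exp 1 / k = 2 * l / \<alpha> * t powr \<beta> + 2 * exp 1 * \<sigma> / \<alpha> * t powr (1/2)"
      using \<alpha> \<sigma> elim by (simp add: s_def k_def powr_half_sqrt)
    also have "\<dots> \<le> C * t powr \<beta>"
      unfolding C_def distrib_right
      using \<alpha> \<sigma> elim \<beta> by (intro add_left_mono mult_left_mono powr_mono) auto
    finally show ?case
      using elim variance_conga_line[OF W \<alpha>, of t] by simp
  qed
qed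

text \<open>
  Ahead of the front, the lower bound multiplies the least squared tail on \<open>s \<le> sqrt (t / ln t)\<close> by the
  length of this range; the upper bound integrates \<open>exp (- (a + b s)\<^sup>2) / a\<^sup>2\<close> after dropping \<open>(b s)\<^sup>2\<close>
  from the exponent.
\<close>

lemma same_order_variance_ahead_of_front:
  assumes W: "standard_brownian_motion M W" and \<alpha>: "0 < \<alpha>" "\<alpha> < 1" and l: "0 < l"
  shows "same_order
    (\<lambda>t. prob_space.variance M (conga_line M W \<alpha> (\<alpha> * t + conga_sigma \<alpha> * sqrt (l * t * ln t)) t))
    (\<lambda>t. t powr (1/2 - l) / (ln t) powr (3/2))"
proof -
  define \<sigma> where "\<sigma> = conga_sigma \<alpha>"
  have \<sigma>: "0 < \<sigma>"
    unfolding \<sigma>_def by (rule conga_sigma_pos[OF \<alpha>])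
  define x where "x t = \<alpha> * t + \<sigma> * sqrt (l * t * ln t)" for t
  have exp_ln: "exp (- (l * ln t)) = t powr (- l)" if "0 < t" for t
    using that by (simp add: powr_def)
  have split_powr: "t powr (1/2 - l) / (ln t) powr (3/2) = t powr (- l) / ln t * (sqrt t / sqrt (ln t))"
    if "1 < t" for t :: real
  proof -
    have "(ln t) powr (3/2) = ln t powr 1 * ln t powr (1/2)"
      unfolding powr_add[symmetric] by simp
    then have "(ln t) powr (3/2) = ln t * sqrt (ln t)"
      using that by (simp add: powr_half_sqrt)
    moreover have "t powr (1/2 - l) = t powr (- l) * sqrt t"
      using that by (simp add: powr_half_sqrt[symmetric] flip: powr_add)
    ultimately show ?thesis by simp
  qed
  \<comment> \<open>the numerator of the argument, in terms of \<open>s = t - z\<close>\<close>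
  have arg_eq: "x t - \<alpha> * z = \<alpha> * (t - z) + \<sigma> * (sqrt l * sqrt (t * ln t))" for t z
    by (simp add: x_def algebra_simps real_sqrt_mult)
  obtain K where K: "0 < K" and defect: "\<forall>\<^sub>F t in at_top.
      ((\<alpha> / \<sigma> * sqrt (t / ln t) + sqrt l * sqrt (t * ln t)) / sqrt (t - sqrt (t / ln t)))\<^sup>2
        \<le> (sqrt l)\<^sup>2 * ln t + K"
    using front_argument_square_le[of "sqrt l" "\<alpha> / \<sigma>"] l \<alpha> \<sigma> by auto
  define \<kappa> :: real where "\<kappa> = exp (- 3 / 2) / sqrt (2 * pi)"
  have \<kappa>: "0 < \<kappa>" by (simp add: \<kappa>_def)
  define c where "c = \<kappa>\<^sup>2 * exp (- K) / (l + K)"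
  define C where "C = \<sigma> / (2 * \<alpha> * l * sqrt l)"
  have "same_order (\<lambda>t. prob_space.variance M (conga_line M W \<alpha> (x t) t))
    (\<lambda>t. t powr (1/2 - l) / (ln t) powr (3/2))"
  proof (rule same_orderI)
    show "\<forall>\<^sub>F t in at_top. 0 < t powr (1/2 - l) / (ln t) powr (3/2)"
      using eventually_gt_at_top[of 1] by eventually_elim simp
    show "0 < c"
      using K \<kappa> l by (simp add: c_def)
    have "\<forall>\<^sub>F t::real in at_top. sqrt (t / ln t) < t" "\<forall>\<^sub>F t::real in at_top. 1 \<le> ln t"
      "\<forall>\<^sub>F t::real in at_top. 1 \<le> l * ln t"
      using l by real_asymp+
    with defect eventually_gt_at_top[of 1]
    show "\<forall>\<^sub>F t in at_top. c * (t powr (1/2 - l) / (ln t) powr (3/2))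
        \<le> prob_space.variance M (conga_line M W \<alpha> (x t) t)"
    proof eventually_elim
      case (elim t)
      define h where "h = sqrt (t / ln t)"
      have h: "0 < h" "h < t"
        using elim by (auto simp: h_def)
      \<comment> \<open>\<open>Y\<close> bounds the argument of the tail on the whole range \<open>s \<le> h\<close>\<close>
      define Y where "Y = sqrt (l * ln t + K)"
      have Y2: "Y\<^sup>2 = l * ln t + K"
        using elim K by (simp add: Y_def)
      have Y1: "1 \<le> Y"
        using elim K by (simp add: Y_def)
      have "(std_normal_tail Y)\<^sup>2 * h \<le> (LINT z:{0..t}|lborel. (conga_kernel \<alpha> (x t) z)\<^sup>2)"
      proof (rule integral_conga_kernel_ge)
        fix z assume z: "t - h \<le> z" "z \<le> t"
        have "(x t - \<alpha> * z) / (\<sigma> * sqrt z)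
            \<le> (\<alpha> * h + \<sigma> * (sqrt l * sqrt (t * ln t))) / (\<sigma> * sqrt (t - h))"
          unfolding arg_eq using z \<alpha> \<sigma> h l elim
          by (intro frac_le add_mono mult_left_mono) auto
        also have "\<dots> = (\<alpha> / \<sigma> * h + sqrt l * sqrt (t * ln t)) / sqrt (t - h)"
          using \<sigma> by (simp add: field_simps)
        also have "\<dots> \<le> Y"
          unfolding Y_def
        proof (rule real_le_rsqrt)
          show "((\<alpha> / \<sigma> * h + sqrt l * sqrt (t * ln t)) / sqrt (t - h))\<^sup>2 \<le> l * ln t + K"
            using elim l by (simp add: h_def)
        qed
        finally show "std_normal_tail Y \<le> conga_kernel \<alpha> (x t) z"
          unfolding \<sigma>_def by (rule std_normal_tail_antimono)
      qed (use h std_normal_tail_nonneg in auto)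
      moreover have "c * (t powr (- l) / ln t) \<le> (std_normal_tail Y)\<^sup>2"
      proof -
        have "c * (t powr (- l) / ln t) = \<kappa>\<^sup>2 * (exp (- K) * t powr (- l)) / ((l + K) * ln t)"
          by (simp add: c_def)
        also have "\<dots> \<le> \<kappa>\<^sup>2 * (exp (- K) * t powr (- l)) / Y\<^sup>2"
          using elim K l by (intro divide_left_mono) (auto simp: Y2 algebra_simps intro!: mult_pos_pos add_pos_pos)
        also have "exp (- K) * t powr (- l) = exp (- Y\<^sup>2)"
          using elim exp_ln[of t] by (simp add: Y2 mult_exp_exp flip: exp_ln)
        also have "\<kappa>\<^sup>2 * exp (- Y\<^sup>2) / Y\<^sup>2 = (\<kappa> * (exp (- Y\<^sup>2 / 2) / Y))\<^sup>2"
          by (simp add: power_mult_distrib power_divide exp_double[symmetric])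
        also have "\<dots> \<le> (std_normal_tail Y)\<^sup>2"
          using std_normal_tail_ge[OF Y1] Y1 \<kappa> by (intro power_mono) (auto simp: \<kappa>_def)
        finally show ?thesis .
      qed
      ultimately have "c * (t powr (- l) / ln t) * h \<le> (LINT z:{0..t}|lborel. (conga_kernel \<alpha> (x t) z)\<^sup>2)"
        using h by (meson less_imp_le mult_right_mono order_trans)
      then show ?case
        using elim variance_conga_line[OF W \<alpha>, of t "x t"] split_powr[of t]
        by (simp add: h_def real_sqrt_divide mult.assoc)
    qed
    show "\<forall>\<^sub>F t in at_top. prob_space.variance M (conga_line M W \<alpha> (x t) t)
        \<le> C * (t powr (1/2 - l) / (ln t) powr (3/2))"
      using eventually_gt_at_top[of 1]
    proof eventually_elim
      case (elim t)
      define a where "a = sqrt l * sqrt (ln t)"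
      have a: "0 < a" "a\<^sup>2 = l * ln t"
        using l elim by (auto simp: a_def power_mult_distrib)
      define b where "b = \<alpha> / (\<sigma> * sqrt t)"
      have b: "0 < b"
        using \<alpha> \<sigma> elim by (simp add: b_def)
      have "(LINT z:{0..t}|lborel. (conga_kernel \<alpha> (x t) z)\<^sup>2) \<le> 0 * 0 + (t powr (- l) / a\<^sup>2) / (2 * a * b)"
      proof (rule integral_conga_kernel_le)
        fix z assume z: "0 < z" "z \<le> t"
        let ?y = "(x t - \<alpha> * z) / (conga_sigma \<alpha> * sqrt z)"
        have "a + b * (t - z) = (\<alpha> * (t - z) + \<sigma> * (sqrt l * sqrt (t * ln t))) / (\<sigma> * sqrt t)"
          using \<sigma> z by (simp add: a_def b_def add_divide_distrib real_sqrt_mult)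
        also have "\<dots> \<le> (\<alpha> * (t - z) + \<sigma> * (sqrt l * sqrt (t * ln t))) / (\<sigma> * sqrt z)"
          using z \<alpha> \<sigma> l elim by (intro frac_le) (auto intro!: add_nonneg_nonneg)
        also have "\<dots> = ?y"
          unfolding arg_eq \<sigma>_def ..
        finally have y: "a + b * (t - z) \<le> ?y" .
        have ay: "a \<le> ?y"
          by (rule order_trans[OF _ y]) (use b z in simp)
        have "a\<^sup>2 + 2 * a * b * (t - z) \<le> (a + b * (t - z))\<^sup>2"
          by (simp add: power2_sum)
        also have "\<dots> \<le> ?y\<^sup>2"
          using y a b z by (intro power_mono) auto
        finally have ysq: "a\<^sup>2 + 2 * a * b * (t - z) \<le> ?y\<^sup>2" .
        have "(std_normal_tail ?y)\<^sup>2 \<le> (exp (- ?y\<^sup>2 / 2) / ?y)\<^sup>2"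
          using ay a by (intro power_mono std_normal_tail_le std_normal_tail_nonneg) linarith
        also have "\<dots> = exp (- ?y\<^sup>2) / ?y\<^sup>2"
          unfolding power_divide[of "exp _"] by (simp only: exp_double[symmetric]) simp
        also have "\<dots> \<le> exp (- (a\<^sup>2 + 2 * a * b * (t - z))) / a\<^sup>2"
          using ysq ay a(1) by (intro frac_le power_mono) auto
        also have "\<dots> = t powr (- l) / a\<^sup>2 * exp (- (2 * a * b) * (t - z))"
          using elim exp_ln[of t] by (simp add: a(2) exp_add[symmetric] exp_diff exp_minus field_simps flip: exp_ln)
        finally show "(std_normal_tail ?y)\<^sup>2
            \<le> 0 * indicator {t - 0..t} z + t powr (- l) / a\<^sup>2 * exp (- (2 * a * b) * (t - z))"
          by simp
      qed (use a(1) b elim in auto)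
      also have "\<dots> = C * (t powr (- l) / ln t * (sqrt t / sqrt (ln t)))"
        unfolding a(2) using \<alpha> \<sigma> l elim by (simp add: a_def b_def C_def field_simps)
      also have "\<dots> = C * (t powr (1/2 - l) / (ln t) powr (3/2))"
        by (simp only: split_powr[OF elim])
      finally show ?case
        using elim variance_conga_line[OF W \<alpha>, of t "x t"] by simp
    qed
  qed
  then show ?thesis
    by (simp only: x_def \<sigma>_def)
qed

theorem theorem3:
  fixes M :: "'a measure" and W :: "real \<Rightarrow> 'a \<Rightarrow> real" and \<alpha> :: real
  assumes "standard_brownian_motion M W"
    and "0 < \<alpha>" and "\<alpha> < 1"
  shows "(\<forall>l \<beta>. 0 < l \<and> 1/2 \<le> \<beta> \<and> \<beta> < 1 \<longrightarrow>
            same_order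
              (\<lambda>t. prob_space.variance M (conga_line M W \<alpha> (\<alpha> * t - l * t powr \<beta>) t))
              (\<lambda>t. t powr \<beta>))
       \<and> (\<forall>l. 0 < l \<longrightarrow>
            same_order
              (\<lambda>t. prob_space.variance M
                 (conga_line M W \<alpha> (\<alpha> * t + conga_sigma \<alpha> * sqrt (l * t * ln t)) t))
              (\<lambda>t. t powr (1/2 - l) / (ln t) powr (3/2)))"
  using same_order_variance_behind_front[OF assms] same_order_variance_ahead_of_front[OF assms]
  by blast

end
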